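(* For every $V\in\mathcal V^*$, the one-centre problem $\ddot u=\nabla V(|u|)$, $(u(0),\dot u(0))=(q_0,p_0)\in(\mathbb R^2\setminus\{0\})\times\mathbb R^2$, is strongly regularizable via smoothing of the potential in the ball $B_0(\bar R)$, where $\bar R=\min\{T_*,S\}$.
   Context: **The classes $\mathcal V$ and $\mathcal V^*$.** $\mathcal V$ is the set of functions $V\in C^\infty(\mathbb R^+,\mathbb R)$, $\mathbb R^+=(0,\infty)$, such that (i) $\lim_{x\to0^+}V(x)=+\infty$; there exists $S\in(0,+\infty]$ such that on $(0,S)$: (ii) $V'(x)<0$ and $V''(x)>0$; (iii) $V'(x)/V''(x)$ is decreasing in $x$; and (iv) $\frac{d}{dx}\frac{V'(x)}{V''(x)}\big|_{x=0}<-\frac12$ (right derivative at $0$ of the function $V'/V''$ extended by continuity to $x=0$). $\mathcal V^*$ is the set of $V\in\mathcal V$ such that (v) $\lim_{\lambda\to0^+}V(\lambda x)/V(\lambda)=1$ for every $x\ge1$, uniformly on every compact $[1,M]$. By (iii), (iv) there is $T_*\in(0,+\infty]$ with $V'(x)/V''(x)\le -x/2$ on $(0,T_* )$. With such $S,T_*$ fixed, $\bar R:=\min\{T_*,S\}$. $B_0(\bar R)$ is the ball of radius $\bar R$ about the origin in $\mathbb R^2$. **Smoothing.** For $\varepsilon>0$, $V_\varepsilon(x)=V(\sqrt{x^2+\varepsilon^2})$. Here $\nabla V(|u|)$ and $\nabla V_\varepsilon(|u|)$ denote gradients with respect to $u\in\mathbb R^2$. For $\nu=(q_0,p_0)$,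 $u_\nu$ is the classical solution of $\ddot u=\nabla V(|u|)$ and $u_{\varepsilon,\nu}$ the solution of $\ddot u=\nabla V_\varepsilon(|u|)$ with initial data $(u(0),\dot u(0))=\nu$. A collision is the configuration $u=0$. $S(V)$ is the set of $\nu=(q_0,p_0)$ with $|q_0|\le\bar R$ whose solution $u_\nu$ reaches the origin at a finite time $T_0=T_0(\nu)>0$, with $|u_\nu(t)|\le\bar R$ for $t\in[0,T_0)$. **Strong regularizability in $B_0(\bar R)$.** The problem is strongly regularizable via smoothing of the potential in $B_0(\bar R)$ if for every $\bar\nu\in S(V)$ there exists the limit $\lim_{(\varepsilon,\nu)\to(0,\bar\nu)}u_{\varepsilon,\nu}=u_0$ (the joint limit as $\varepsilon\to0^+$ and $\nu\to\bar\nu$ in $\mathbb R^2\times\mathbb R^2$, with no relation between $\varepsilon$ and $\nu$), and the flow $$\tilde u_\nu(t)=\begin{cases}u_\nu(t),&\nu\notin S(V)\\ u_0(t),&\nu\in S(V)\ \ (u_0\text{ being the limit path associated with }\bar\nu=\nu)\end{cases}$$ is continuous with respect to $\nu$. Both the limit and the continuity are understood within $B_0(\bar R)$ and pointwise in time: the limit $u_0(t)=\lim u_{\varepsilon,\nu}(t)$ is required for every $t\in[0,2T_0(\bar\nu)]$, and, for each fixed $t\geq 0$, $\nu\mapsto\tilde u_\nu(t)$ is required to be continuous on the set of $\nu$ with $|q_0|\le\bar R$ for which it is defined (for $\nu\in S(V)$: $t\in[0,2T_0(\nu)]$; for $\nu\notin S(V)$: as long as $u_\nu$ has remained in $\{|u|\le\bar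 R\}$ on $[0,t]$). *)

theory Defs
  imports "HOL-Analysis.Analysis"
begin

text \<open>Potentials are total functions on the reals; only their values on \<open>(0,\<infinity>)\<close> matter.\<close>

definition smooth_pos :: "(real \<Rightarrow> real) \<Rightarrow> bool" where
  "smooth_pos V \<longleftrightarrow> (\<forall>n. \<forall>x>0. (deriv ^^ n) V differentiable at x)"

definition ratio :: "(real \<Rightarrow> real) \<Rightarrow> real \<Rightarrow> real" where
  "ratio V x = deriv V x / deriv (deriv V) x"

text \<open>\<open>V'/V''\<close> decreasing is read in the weak sense (non-increasing).\<close>

definition admissible_bound :: "(real \<Rightarrow> real) \<Rightarrow> ereal \<Rightarrow> bool" where
  "admissible_bound V S \<longleftrightarrow>
     0 < S \<and>
     (\<forall>x. 0 < x \<and> ereal x < S \<longrightarrow> deriv V x < 0 \<and> deriv (deriv V) x > 0) \<and>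
     antimono_on {x. 0 < x \<and> ereal x < S} (ratio V)"

text \<open>\<open>L\<close> is the value at \<open>0\<close> of the continuous extension of \<open>V'/V''\<close>,
  and \<open>D\<close> its right derivative there.\<close>

definition slope_condition :: "(real \<Rightarrow> real) \<Rightarrow> bool" where
  "slope_condition V \<longleftrightarrow>
     (\<exists>L D. (ratio V \<longlongrightarrow> L) (at_right 0) \<and>
        ((\<lambda>x. if x = 0 then L else ratio V x) has_real_derivative D) (at_right 0) \<and>
        D < - 1 / 2)"

definition class_V :: "(real \<Rightarrow> real) set" where
  "class_V = {V. smooth_pos V \<and> filterlim V at_top (at_right 0) \<and>
                 (\<exists>S. admissible_bound V S) \<and> slope_condition V}"

definition class_V_star :: "(real \<Rightarrow> real) set" where
  "class_V_star = {V \<in> class_V.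
     \<forall>M\<ge>1. uniform_limit {1..M} (\<lambda>l x. V (l * x) / V l) (\<lambda>x. 1) (at_right 0)}"

definition T_star_bound :: "(real \<Rightarrow> real) \<Rightarrow> ereal \<Rightarrow> bool" where
  "T_star_bound V T \<longleftrightarrow> 0 < T \<and> (\<forall>x. 0 < x \<and> ereal x < T \<longrightarrow> ratio V x \<le> - x / 2)"

definition smoothing :: "(real \<Rightarrow> real) \<Rightarrow> real \<Rightarrow> real \<Rightarrow> real" where
  "smoothing V \<epsilon> x = V (sqrt (x\<^sup>2 + \<epsilon>\<^sup>2))"

type_synonym state = "(real^2) \<times> (real^2)"

text \<open>\<open>u\<close> solves \<open>u'' = \<nabla>U(u)\<close> on the time interval \<open>I\<close> (which contains \<open>0\<close>), inside the
  configuration space \<open>D\<close>, with initial position and velocity \<open>\<nu>\<close>.\<close>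

definition newton_solution ::
  "(real^2 \<Rightarrow> real) \<Rightarrow> (real^2) set \<Rightarrow> real set \<Rightarrow> state \<Rightarrow> (real \<Rightarrow> real^2) \<Rightarrow> bool" where
  "newton_solution U D I \<nu> u \<longleftrightarrow>
     (\<exists>v. u 0 = fst \<nu> \<and> v 0 = snd \<nu> \<and>
        (\<forall>t\<in>I. u t \<in> D \<and> (u has_vector_derivative v t) (at t within I) \<and>
           (\<exists>a. (v has_vector_derivative a) (at t within I) \<and> (GDERIV U (u t) :> a))))"

text \<open>Value at time \<open>t\<close> of the solution with initial data \<open>\<nu>\<close>; meaningful when a solution
  exists on \<open>[0,t]\<close>.\<close>

definition newton_flow ::
  "(real^2 \<Rightarrow> real) \<Rightarrow> (real^2) set \<Rightarrow> state \<Rightarrow> real \<Rightarrow> real^2" where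
  "newton_flow U D \<nu> t = (THE x. \<exists>u. newton_solution U D {0..t} \<nu> u \<and> u t = x)"

abbreviation classical_solution ::
  "(real \<Rightarrow> real) \<Rightarrow> real set \<Rightarrow> state \<Rightarrow> (real \<Rightarrow> real^2) \<Rightarrow> bool" where
  "classical_solution V \<equiv> newton_solution (\<lambda>x. V (norm x)) (- {0})"

abbreviation classical_flow :: "(real \<Rightarrow> real) \<Rightarrow> state \<Rightarrow> real \<Rightarrow> real^2" where
  "classical_flow V \<equiv> newton_flow (\<lambda>x. V (norm x)) (- {0})"

abbreviation smoothed_solution ::
  "(real \<Rightarrow> real) \<Rightarrow> real \<Rightarrow> real set \<Rightarrow> state \<Rightarrow> (real \<Rightarrow> real^2) \<Rightarrow> bool" where
  "smoothed_solution V \<epsilon> \<equiv> newton_solution (\<lambda>x. smoothing V \<epsilon> (norm x)) UNIV"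

abbreviation smoothed_flow :: "(real \<Rightarrow> real) \<Rightarrow> real \<Rightarrow> state \<Rightarrow> real \<Rightarrow> real^2" where
  "smoothed_flow V \<epsilon> \<equiv> newton_flow (\<lambda>x. smoothing V \<epsilon> (norm x)) UNIV"

text \<open>The solution with initial data \<open>\<nu>\<close> reaches the origin at time \<open>T\<close>, remaining in the
  ball of radius \<open>R\<close> on \<open>[0,T)\<close>. By uniqueness of classical solutions, \<open>\<nu>\<close> determines \<open>T\<close>.\<close>

definition collides_at :: "(real \<Rightarrow> real) \<Rightarrow> ereal \<Rightarrow> state \<Rightarrow> real \<Rightarrow> bool" where
  "collides_at V R \<nu> T \<longleftrightarrow>
     0 < T \<and>
     (\<exists>u. classical_solution V {0..<T} \<nu> u \<and>
          (\<forall>t\<in>{0..<T}. ereal (norm (u t)) \<le> R) \<and>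
          (u \<longlongrightarrow> 0) (at_left T))"

definition collision_set :: "(real \<Rightarrow> real) \<Rightarrow> ereal \<Rightarrow> state set" where
  "collision_set V R = {\<nu>. ereal (norm (fst \<nu>)) \<le> R \<and> (\<exists>T. collides_at V R \<nu> T)}"

text \<open>The joint limit \<open>(\<epsilon>,\<mu>) \<rightarrow> (0+,\<nu>)\<close> of the smoothed solutions at time \<open>t\<close>. Its existence
  includes that these solutions are defined up to time \<open>t\<close> for all \<open>(\<epsilon>,\<mu>)\<close> close to the limit.\<close>

definition smoothing_limit ::
  "(real \<Rightarrow> real) \<Rightarrow> state \<Rightarrow> real \<Rightarrow> real^2 \<Rightarrow> bool" where
  "smoothing_limit V \<nu> t y \<longleftrightarrow>
     (\<forall>\<^sub>F (\<epsilon>, \<mu>) in at_right 0 \<times>\<^sub>F nhds \<nu>. \<exists>u. smoothed_solution V \<epsilon> {0..t} \<mu> u) \<and>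
     ((\<lambda>(\<epsilon>, \<mu>). smoothed_flow V \<epsilon> \<mu> t) \<longlongrightarrow> y) (at_right 0 \<times>\<^sub>F nhds \<nu>)"

text \<open>In the next two definitions \<open>w \<nu>\<close> is the limit path attached to a collision datum \<open>\<nu>\<close>.\<close>

definition regularized_flow ::
  "(real \<Rightarrow> real) \<Rightarrow> ereal \<Rightarrow> (state \<Rightarrow> real \<Rightarrow> real^2) \<Rightarrow> state \<Rightarrow> real \<Rightarrow> real^2" where
  "regularized_flow V R w \<nu> t =
     (if \<nu> \<in> collision_set V R then w \<nu> t else classical_flow V \<nu> t)"

definition regularized_domain :: "(real \<Rightarrow> real) \<Rightarrow> ereal \<Rightarrow> real \<Rightarrow> state set" where
  "regularized_domain V R t =
     {\<nu>. ereal (norm (fst \<nu>)) \<le> R \<and>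
         (if \<nu> \<in> collision_set V R
          then \<exists>T. collides_at V R \<nu> T \<and> t \<le> 2 * T
          else \<exists>u. classical_solution V {0..t} \<nu> u \<and> (\<forall>s\<in>{0..t}. ereal (norm (u s)) \<le> R))}"

definition strongly_regularizable :: "(real \<Rightarrow> real) \<Rightarrow> ereal \<Rightarrow> bool" where
  "strongly_regularizable V R \<longleftrightarrow>
     (\<exists>w. (\<forall>\<nu>\<in>collision_set V R. \<forall>T. collides_at V R \<nu> T \<longrightarrow>
              (\<forall>t\<in>{0..2 * T}. smoothing_limit V \<nu> t (w \<nu> t))) \<and>
          (\<forall>t\<ge>0. continuous_on (regularized_domain V R t) (\<lambda>\<nu>. regularized_flow V R w \<nu> t)))"

end

theory Submission
  imports Defs
begin

text \<open>Classical and smoothed motions (\<open>\<epsilon> = 0\<close> and \<open>\<epsilon> > 0\<close>) are treated uniformly, with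
  \<open>\<sigma> = |u|\<^sup>2 + \<epsilon>\<^sup>2\<close> in place of \<open>|u|\<^sup>2\<close>. Away from the centre only continuous dependence on
  \<open>(\<epsilon>, \<nu>)\<close> is used. A collision orbit is radial near the collision, with velocity direction
  \<open>e\<close>, say. As \<open>V\<close> is convex and slowly varying, \<open>r V'(r) = o(V(r))\<close>, so on the way in
  to its pericentre a nearby motion turns its velocity by an angle that is small compared with
  the polar angle it sweeps, hence small; also the pericentre time is close to the collision time.
  Uniqueness makes a motion symmetric about its pericentre: the way out is the time reversal of the
  way in, reflected in the hyperplane orthogonal to the pericentre velocity. In the limit this
  reflection maps \<open>e\<close> to \<open>- e\<close>, so the collision orbit is continued straight through the
  centre, by \<open>t \<mapsto> - u (2 T - t)\<close>.\<close>

section \<open>Central motions\<close>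

text \<open>The joint limit prescribes no relation between \<epsilon>, the angular momentum and the
  distance from the collision datum, so no estimate near the centre may rest on comparing them. The
  passage bounds therefore use only an energy bound \<open>H\<close> and a radius
  \<open>\<rho>\<close>. Smoothing does no harm there: passing from \<sigma> to |u|^2 only weakens
  the attraction term. A nearby motion need not reach a pericentre within the time considered, nor
  is it known to exist up to time 2T. Every estimate is therefore made on [0, c] with
  \<open>c\<close> free, and then supplies the a priori bound from which the smoothed motions are
  shown to exist. The reflection alone does not reach time 2T: if the pericentre time p is less than
  T, the mirror time 2p - t is negative for t near 2T. It is used only up to a time T + \<tau>
  shortly after the collision; from there continuous dependence along the mirrored classical orbit
  takes over.\<close>

lemma nondecreasing_within:
  fixes f :: "real \<Rightarrow> real"
  assumes "a \<le> b" and "\<And>t. t \<in> {a..b} \<Longrightarrow> (f has_real_derivative f' t) (at t within {a..b})"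
    and "\<And>t. t \<in> {a..b} \<Longrightarrow> k \<le> f' t"
  shows "f a + k * (b - a) \<le> f b"
proof -
  obtain x where x: "x \<in> {a..b}" "f b - f a = f' x * (b - a)"
    using mvt_very_simple[OF assms(1), of f "\<lambda>x h. f' x * h"] assms(2)
    unfolding has_field_derivative_def by (auto simp: mult_commute_abs)
  have "k * (b - a) \<le> f' x * (b - a)"
    using assms(1,3) x(1) by (intro mult_right_mono) auto
  with x(2) show ?thesis by linarith
qed

lemma gronwall_within:
  fixes y :: "real \<Rightarrow> real"
  assumes "a \<le> b" and "\<And>t. t \<in> {a..b} \<Longrightarrow> (y has_real_derivative y' t) (at t within {a..b})"
    and "\<And>t. t \<in> {a..b} \<Longrightarrow> y' t \<le> C * y t"
  shows "y b \<le> y a * exp (C * (b - a))"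
proof -
  have "(- (y a * exp (- C * a))) + 0 * (b - a) \<le> - (y b * exp (- C * b))"
  proof (rule nondecreasing_within[OF assms(1), of _ "\<lambda>t. (C * y t - y' t) * exp (- C * t)"])
    fix t assume t: "t \<in> {a..b}"
    show "((\<lambda>t. - (y t * exp (- C * t))) has_real_derivative (C * y t - y' t) * exp (- C * t)) (at t within {a..b})"
      by (rule derivative_eq_intros assms(2)[OF t] refl)+ (auto simp: algebra_simps)
    show "0 \<le> (C * y t - y' t) * exp (- C * t)"
      using assms(3)[OF t] by simp
  qed
  then have "y b * exp (- C * b) * exp (C * b) \<le> y a * exp (- C * a) * exp (C * b)"
    by (intro mult_right_mono) auto
  then show ?thesis
    by (simp add: mult.assoc flip: exp_add) (simp add: algebra_simps)
qed

text \<open>With \<open>\<sigma> = |u|\<^sup>2 + \<epsilon>\<^sup>2\<close> the equation of motion is \<open>u'' = force_coeff V \<sigma> u\<close>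
  for the smoothed problems, and for the classical one when \<open>\<epsilon> = 0\<close>.\<close>

definition force_coeff :: "(real \<Rightarrow> real) \<Rightarrow> real \<Rightarrow> real" where
  "force_coeff V \<sigma> = deriv V (sqrt \<sigma>) / sqrt \<sigma>"

lemma smooth_pos_deriv:
  assumes "smooth_pos V" "0 < x"
  shows "(V has_real_derivative deriv V x) (at x)"
    and "(deriv V has_real_derivative deriv (deriv V) x) (at x)"
    and "isCont (deriv (deriv V)) x"
proof -
  have *: "(deriv ^^ n) V differentiable at x" for n
    using assms by (auto simp: smooth_pos_def)
  show "(V has_real_derivative deriv V x) (at x)"
    using *[of 0] by (simp add: DERIV_deriv_iff_real_differentiable)
  show "(deriv V has_real_derivative deriv (deriv V) x) (at x)"
    using *[of 1] by (simp add: DERIV_deriv_iff_real_differentiable)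
  show "isCont (deriv (deriv V)) x"
    using *[of 2] by (simp add: numeral_2_eq_2 differentiable_imp_continuous_within)
qed

text \<open>The gradient of x \<bullet> x + \<epsilon>^2 is 2x, which cancels the factor 1/2: the
  smoothed force is \<open>force_coeff V \<sigma>\<close> times the position.\<close>

lemma potential_sqrt_derivative:
  assumes "smooth_pos V" "0 < \<sigma>"
  shows "((\<lambda>\<sigma>. V (sqrt \<sigma>)) has_real_derivative force_coeff V \<sigma> / 2) (at \<sigma>)"
proof -
  have "(V has_real_derivative deriv V (sqrt \<sigma>)) (at (sqrt \<sigma>))"
    using assms by (intro smooth_pos_deriv) auto
  from DERIV_chain2[OF this DERIV_real_sqrt[OF assms(2)]] show ?thesis
    by (simp add: force_coeff_def field_simps)
qed

text \<open>The derivative is bounded on the compact interval because the second derivative of V is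
  continuous.\<close>

lemma force_coeff_lipschitz:
  assumes "smooth_pos V" "0 < m"
  obtains L where "0 \<le> L" "\<And>\<sigma> \<sigma>'. \<sigma> \<in> {m..M} \<Longrightarrow> \<sigma>' \<in> {m..M} \<Longrightarrow>
    \<bar>force_coeff V \<sigma> - force_coeff V \<sigma>'\<bar> \<le> L * \<bar>\<sigma> - \<sigma>'\<bar>"
proof -
  define D where "D \<sigma> = (deriv (deriv V) (sqrt \<sigma>) * (inverse (sqrt \<sigma>) / 2) * sqrt \<sigma> -
       deriv V (sqrt \<sigma>) * (inverse (sqrt \<sigma>) / 2)) / (sqrt \<sigma> * sqrt \<sigma>)" for \<sigma>
  have der: "(force_coeff V has_real_derivative D \<sigma>) (at \<sigma>)" if "0 < \<sigma>" for \<sigma>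
  proof -
    have "(deriv V has_real_derivative deriv (deriv V) (sqrt \<sigma>)) (at (sqrt \<sigma>))"
      using assms that by (intro smooth_pos_deriv) auto
    from DERIV_divide[OF DERIV_chain2[OF this DERIV_real_sqrt[OF that]] DERIV_real_sqrt[OF that]]
    show ?thesis
      using that by (simp add: force_coeff_def[abs_def] D_def)
  qed
  have c1: "continuous_on {0<..} (deriv V)"
    using assms smooth_pos_deriv(2) DERIV_isCont
    by (metis continuous_at_imp_continuous_on greaterThan_iff)
  have c2: "continuous_on {0<..} (deriv (deriv V))"
    using assms smooth_pos_deriv(3) by (metis continuous_at_imp_continuous_on greaterThan_iff)
  have "continuous_on {m..M} D"
    unfolding D_def using assms(2)
    by (intro continuous_intros continuous_on_compose2[OF c1] continuous_on_compose2[OF c2]) auto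
  then obtain B where B: "\<And>\<sigma>. \<sigma> \<in> {m..M} \<Longrightarrow> norm (D \<sigma>) \<le> B"
    using compact_continuous_image[OF _ compact_Icc] compact_imp_bounded bounded_iff
    by (metis image_eqI)
  show ?thesis
  \<comment> \<open>\<open>max B 0\<close> covers the empty interval, on which nothing forces
    \<open>B\<close> to be nonnegative.\<close>
  proof (rule that[of "max B 0"])
    fix \<sigma> \<sigma>' assume *: "\<sigma> \<in> {m..M}" "\<sigma>' \<in> {m..M}"
    have "norm (force_coeff V \<sigma> - force_coeff V \<sigma>') \<le> max B 0 * norm (\<sigma> - \<sigma>')"
    proof (rule field_differentiable_bound[of "{m..M}" _ D])
      fix z assume z: "z \<in> {m..M}"
      show "(force_coeff V has_field_derivative D z) (at z within {m..M})"
        using der[of z] z assms(2) by (auto intro: has_field_derivative_at_within)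
      show "norm (D z) \<le> max B 0" using B[OF z] by simp
    qed (use * in auto)
    then show "\<bar>force_coeff V \<sigma> - force_coeff V \<sigma>'\<bar> \<le> max B 0 * \<bar>\<sigma> - \<sigma>'\<bar>" by simp
  qed simp
qed

text \<open>One constant serves all \<epsilon> and \<epsilon>' with \<sigma> in [m, M], and the
  parameters enter through their squares only. This lets a classical and a smoothed motion be
  compared directly.\<close>

lemma force_lipschitz:
  fixes V :: "real \<Rightarrow> real"
  assumes "smooth_pos V" "0 < m"
  obtains L where "0 \<le> L"
    "\<And>\<epsilon> \<epsilon>' (x::'a::real_inner) y. x \<bullet> x + \<epsilon>\<^sup>2 \<in> {m..M} \<Longrightarrow> y \<bullet> y + \<epsilon>'\<^sup>2 \<in> {m..M} \<Longrightarrow>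
      norm (force_coeff V (x \<bullet> x + \<epsilon>\<^sup>2) *\<^sub>R x - force_coeff V (y \<bullet> y + \<epsilon>'\<^sup>2) *\<^sub>R y)
        \<le> L * (norm (x - y) + \<bar>\<epsilon>\<^sup>2 - \<epsilon>'\<^sup>2\<bar>)"
proof -
  obtain L where L: "0 \<le> L" "\<And>\<sigma> \<sigma>'. \<sigma> \<in> {m..M} \<Longrightarrow> \<sigma>' \<in> {m..M} \<Longrightarrow>
    \<bar>force_coeff V \<sigma> - force_coeff V \<sigma>'\<bar> \<le> L * \<bar>\<sigma> - \<sigma>'\<bar>"
    using force_coeff_lipschitz[OF assms] by blast
  \<comment> \<open>\<open>Q\<close> bounds the positions, and \<open>B\<close> the coefficient, by
    the Lipschitz bound from the base point \<open>m\<close>; \<open>max M 0\<close> keeps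
    \<open>Q\<close> nonnegative.\<close>
  define Q where "Q = sqrt (max M 0)"
  define B where "B = \<bar>force_coeff V m\<bar> + L * \<bar>M - m\<bar>"
  have B0: "0 \<le> B" unfolding B_def using L(1) by simp
  have Q0: "0 \<le> Q" unfolding Q_def by simp
  show ?thesis
  proof (rule that[of "B + 2 * L * Q * Q + L * Q"])
    show "0 \<le> B + 2 * L * Q * Q + L * Q" using L(1) B0 Q0 by simp
    fix \<epsilon> \<epsilon>' and x y :: 'a
    assume x: "x \<bullet> x + \<epsilon>\<^sup>2 \<in> {m..M}" and y: "y \<bullet> y + \<epsilon>'\<^sup>2 \<in> {m..M}"
    have nx: "norm x \<le> Q" unfolding Q_def norm_eq_sqrt_inner using x
      by (intro real_sqrt_le_mono) (smt (verit) atLeastAtMost_iff zero_le_power2)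
    have ny: "norm y \<le> Q" unfolding Q_def norm_eq_sqrt_inner using y
      by (intro real_sqrt_le_mono) (smt (verit) atLeastAtMost_iff zero_le_power2)
    define g where "g = force_coeff V (x \<bullet> x + \<epsilon>\<^sup>2)"
    define g' where "g' = force_coeff V (y \<bullet> y + \<epsilon>'\<^sup>2)"
    have "m \<in> {m..M}" using x by auto
    from L(2)[OF x this] have "\<bar>g - force_coeff V m\<bar> \<le> L * \<bar>x \<bullet> x + \<epsilon>\<^sup>2 - m\<bar>"
      by (simp add: g_def)
    also have "\<dots> \<le> L * \<bar>M - m\<bar>" using x L(1) by (intro mult_left_mono) auto
    finally have gB: "\<bar>g\<bar> \<le> B" unfolding B_def by linarith
    have xy: "\<bar>x \<bullet> x - y \<bullet> y\<bar> \<le> 2 * Q * norm (x - y)"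
    proof -
      have "x \<bullet> x - y \<bullet> y = (x - y) \<bullet> (x + y)" by (simp add: algebra_simps inner_commute)
      also have "\<bar>\<dots>\<bar> \<le> norm (x - y) * norm (x + y)" by (rule Cauchy_Schwarz_ineq2)
      also have "\<dots> \<le> norm (x - y) * (2 * Q)"
        using nx ny norm_triangle_ineq[of x y] by (intro mult_left_mono) auto
      finally show ?thesis by (simp add: mult_ac)
    qed
    have "\<bar>g - g'\<bar> \<le> L * \<bar>(x \<bullet> x + \<epsilon>\<^sup>2) - (y \<bullet> y + \<epsilon>'\<^sup>2)\<bar>"
      unfolding g_def g'_def by (rule L(2)[OF x y])
    also have "\<dots> \<le> L * (2 * Q * norm (x - y) + \<bar>\<epsilon>\<^sup>2 - \<epsilon>'\<^sup>2\<bar>)"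
      using xy L(1) by (intro mult_left_mono) linarith+
    finally have gg: "\<bar>g - g'\<bar> \<le> L * (2 * Q * norm (x - y) + \<bar>\<epsilon>\<^sup>2 - \<epsilon>'\<^sup>2\<bar>)" .
    have "norm (g *\<^sub>R x - g' *\<^sub>R y) = norm (g *\<^sub>R (x - y) + (g - g') *\<^sub>R y)"
      by (simp add: algebra_simps)
    also have "\<dots> \<le> \<bar>g\<bar> * norm (x - y) + \<bar>g - g'\<bar> * norm y"
      by (metis norm_scaleR norm_triangle_ineq)
    also have "\<dots> \<le> B * norm (x - y) + L * (2 * Q * norm (x - y) + \<bar>\<epsilon>\<^sup>2 - \<epsilon>'\<^sup>2\<bar>) * Q"
      using gB gg ny Q0 L(1) by (intro add_mono mult_mono) auto
    also have "\<dots> \<le> (B + 2 * L * Q * Q + L * Q) * (norm (x - y) + \<bar>\<epsilon>\<^sup>2 - \<epsilon>'\<^sup>2\<bar>)"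
      using B0 Q0 L(1) by (simp add: algebra_simps)
    finally show "norm (force_coeff V (x \<bullet> x + \<epsilon>\<^sup>2) *\<^sub>R x - force_coeff V (y \<bullet> y + \<epsilon>'\<^sup>2) *\<^sub>R y)
        \<le> (B + 2 * L * Q * Q + L * Q) * (norm (x - y) + \<bar>\<epsilon>\<^sup>2 - \<epsilon>'\<^sup>2\<bar>)"
      by (simp add: g_def g'_def)
  qed
qed

text \<open>For \<epsilon> = 0 positivity of \<sigma> says that the motion avoids the centre. No
  initial time is distinguished, so restrictions and time reversals are again central
  motions.\<close>

definition central_motion ::
  "(real \<Rightarrow> real) \<Rightarrow> real \<Rightarrow> real set \<Rightarrow> (real \<Rightarrow> 'a::real_inner) \<Rightarrow> (real \<Rightarrow> 'a) \<Rightarrow> bool" where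
  "central_motion V \<epsilon> I u v \<longleftrightarrow>
     (\<forall>t\<in>I. 0 < u t \<bullet> u t + \<epsilon>\<^sup>2 \<and> (u has_vector_derivative v t) (at t within I) \<and>
        (v has_vector_derivative force_coeff V (u t \<bullet> u t + \<epsilon>\<^sup>2) *\<^sub>R u t) (at t within I))"

lemma central_motionD:
  assumes "central_motion V \<epsilon> I u v" "t \<in> I"
  shows "0 < u t \<bullet> u t + \<epsilon>\<^sup>2" "(u has_vector_derivative v t) (at t within I)"
    "(v has_vector_derivative force_coeff V (u t \<bullet> u t + \<epsilon>\<^sup>2) *\<^sub>R u t) (at t within I)"
  using assms by (auto simp: central_motion_def)

lemma central_motion_subset:
  assumes "central_motion V \<epsilon> I u v" "J \<subseteq> I"
  shows "central_motion V \<epsilon> J u v"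
  using assms unfolding central_motion_def
  by (meson has_vector_derivative_within_subset subsetD)

lemma central_motion_continuous:
  assumes "central_motion V \<epsilon> I u v"
  shows "continuous_on I u" "continuous_on I v"
  using assms unfolding central_motion_def
  by (meson continuous_on_eq_continuous_within has_vector_derivative_continuous)+

lemma inner_has_real_derivative:
  fixes f g :: "real \<Rightarrow> 'a::real_inner"
  assumes "(f has_vector_derivative f') (at t within I)" "(g has_vector_derivative g') (at t within I)"
  shows "((\<lambda>t. f t \<bullet> g t) has_real_derivative f t \<bullet> g' + f' \<bullet> g t) (at t within I)"
proof -
  have "((\<lambda>t. f t \<bullet> g t) has_derivative (\<lambda>h. f t \<bullet> (h *\<^sub>R g') + (h *\<^sub>R f') \<bullet> g t)) (at t within I)"
    using assms unfolding has_vector_derivative_def by (rule has_derivative_inner)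
  then show ?thesis
    unfolding has_field_derivative_def
    by (rule has_derivative_eq_rhs) (auto simp: algebra_simps)
qed

text \<open>The gap \<epsilon>^2 - \<epsilon>'^2 is counted as a constant component of the
  difference of states. The differential inequality is then homogeneous, and one Gronwall estimate
  covers parameters and initial data; \<open>C\<close> depends only on V and the range of
  \<sigma>.\<close>

lemma central_motion_gronwall:
  fixes V :: "real \<Rightarrow> real"
  assumes "smooth_pos V" "0 < m"
  obtains C where "\<And>a b \<epsilon> \<epsilon>' (u::real \<Rightarrow> 'a::real_inner) v w z. a \<le> b \<Longrightarrow>
      central_motion V \<epsilon> {a..b} u v \<Longrightarrow> central_motion V \<epsilon>' {a..b} w z \<Longrightarrow>
      (\<And>t. t \<in> {a..b} \<Longrightarrow> u t \<bullet> u t + \<epsilon>\<^sup>2 \<in> {m..M} \<and> w t \<bullet> w t + \<epsilon>'\<^sup>2 \<in> {m..M}) \<Longrightarrow>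
      (norm (u b - w b))\<^sup>2 + (norm (v b - z b))\<^sup>2 + (\<epsilon>\<^sup>2 - \<epsilon>'\<^sup>2)\<^sup>2
       \<le> ((norm (u a - w a))\<^sup>2 + (norm (v a - z a))\<^sup>2 + (\<epsilon>\<^sup>2 - \<epsilon>'\<^sup>2)\<^sup>2) * exp (C * (b - a))"
proof -
  obtain L where L: "0 \<le> L"
    "\<And>\<epsilon> \<epsilon>' (x::'a::real_inner) y. x \<bullet> x + \<epsilon>\<^sup>2 \<in> {m..M} \<Longrightarrow> y \<bullet> y + \<epsilon>'\<^sup>2 \<in> {m..M} \<Longrightarrow>
      norm (force_coeff V (x \<bullet> x + \<epsilon>\<^sup>2) *\<^sub>R x - force_coeff V (y \<bullet> y + \<epsilon>'\<^sup>2) *\<^sub>R y)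
        \<le> L * (norm (x - y) + \<bar>\<epsilon>\<^sup>2 - \<epsilon>'\<^sup>2\<bar>)"
    using force_lipschitz[OF assms] by blast
  show ?thesis
  \<comment> \<open>The 1 comes from 2 p \<bullet> q \<le> |p|^2 + |q|^2, and 2L from 2 q \<bullet>
    F \<le> L (2 |q|^2 + |p|^2 + k^2).\<close>
  proof (rule that[of "1 + 2 * L"])
    fix a b \<epsilon> \<epsilon>' and u v w z :: "real \<Rightarrow> 'a"
    assume ab: "a \<le> b" and uv: "central_motion V \<epsilon> {a..b} u v" and wz: "central_motion V \<epsilon>' {a..b} w z"
      and r: "\<And>t. t \<in> {a..b} \<Longrightarrow> u t \<bullet> u t + \<epsilon>\<^sup>2 \<in> {m..M} \<and> w t \<bullet> w t + \<epsilon>'\<^sup>2 \<in> {m..M}"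
    define p where "p t = u t - w t" for t
    define q where "q t = v t - z t" for t
    define k where "k = \<bar>\<epsilon>\<^sup>2 - \<epsilon>'\<^sup>2\<bar>"
    define F where "F t = force_coeff V (u t \<bullet> u t + \<epsilon>\<^sup>2) *\<^sub>R u t - force_coeff V (w t \<bullet> w t + \<epsilon>'\<^sup>2) *\<^sub>R w t" for t
    have "(p b \<bullet> p b + q b \<bullet> q b + k\<^sup>2) \<le> (p a \<bullet> p a + q a \<bullet> q a + k\<^sup>2) * exp ((1 + 2 * L) * (b - a))"
    proof (rule gronwall_within[OF ab, of "\<lambda>t. p t \<bullet> p t + q t \<bullet> q t + k\<^sup>2" "\<lambda>t. (p t \<bullet> q t + q t \<bullet> p t) + (q t \<bullet> F t + F t \<bullet> q t)"])
      fix t assume t: "t \<in> {a..b}"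
      have dp: "(p has_vector_derivative q t) (at t within {a..b})"
        unfolding p_def[abs_def] q_def
        by (intro derivative_intros central_motionD[OF uv t] central_motionD[OF wz t])
      have dq: "(q has_vector_derivative F t) (at t within {a..b})"
        unfolding q_def[abs_def] F_def
        by (intro derivative_intros central_motionD[OF uv t] central_motionD[OF wz t])
      show "((\<lambda>t. p t \<bullet> p t + q t \<bullet> q t + k\<^sup>2) has_real_derivative (p t \<bullet> q t + q t \<bullet> p t) + (q t \<bullet> F t + F t \<bullet> q t)) (at t within {a..b})"
        by (rule derivative_eq_intros inner_has_real_derivative dp dq refl)+ simp
      have F: "norm (F t) \<le> L * (norm (p t) + k)"
        unfolding F_def p_def k_def using r[OF t] by (intro L(2)) auto
      have 1: "2 * (p t \<bullet> q t) \<le> (norm (p t))\<^sup>2 + (norm (q t))\<^sup>2"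
        using norm_cauchy_schwarz[of "p t" "q t"] sum_squares_bound[of "norm (p t)" "norm (q t)"] by linarith
      have "q t \<bullet> F t \<le> norm (q t) * (L * (norm (p t) + k))"
        using norm_cauchy_schwarz[of "q t" "F t"] mult_left_mono[OF F norm_ge_zero[of "q t"]] by linarith
      also have "\<dots> = L * (norm (q t) * norm (p t)) + L * (norm (q t) * k)" by (simp add: algebra_simps)
      also have "\<dots> \<le> L * (((norm (q t))\<^sup>2 + (norm (p t))\<^sup>2) / 2) + L * (((norm (q t))\<^sup>2 + k\<^sup>2) / 2)"
        using sum_squares_bound[of "norm (q t)" "norm (p t)"] sum_squares_bound[of "norm (q t)" k] L(1)
        by (intro add_mono mult_left_mono) (auto simp: field_simps)
      finally have 2: "2 * (q t \<bullet> F t) \<le> L * ((norm (q t))\<^sup>2 + (norm (p t))\<^sup>2 + (norm (q t))\<^sup>2 + k\<^sup>2)"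
        by (simp add: field_simps)
      have "L * (norm (p t))\<^sup>2 \<ge> 0" "L * k\<^sup>2 \<ge> 0" "k\<^sup>2 \<ge> 0" using L(1) by auto
      with 1 2 show "(p t \<bullet> q t + q t \<bullet> p t) + (q t \<bullet> F t + F t \<bullet> q t) \<le> (1 + 2 * L) * (p t \<bullet> p t + q t \<bullet> q t + k\<^sup>2)"
        unfolding power2_norm_eq_inner ring_distribs mult.assoc inner_commute[of "F t" "q t"] inner_commute[of "q t" "p t"]
        by linarith
    qed
    then show "(norm (u b - w b))\<^sup>2 + (norm (v b - z b))\<^sup>2 + (\<epsilon>\<^sup>2 - \<epsilon>'\<^sup>2)\<^sup>2
       \<le> ((norm (u a - w a))\<^sup>2 + (norm (v a - z a))\<^sup>2 + (\<epsilon>\<^sup>2 - \<epsilon>'\<^sup>2)\<^sup>2) * exp ((1 + 2 * L) * (b - a))"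
      by (simp add: power2_norm_eq_inner p_def q_def k_def)
  qed
qed

section \<open>Conservation laws and dependence on initial data\<close>

text \<open>The equation has +grad V on the right, so the energy is kinetic minus V: the speed
  becomes infinite where V does.\<close>

lemma central_motion_energy:
  assumes "smooth_pos V" "central_motion V \<epsilon> {a..b} u v" "a \<le> b"
  shows "v b \<bullet> v b / 2 - V (sqrt (u b \<bullet> u b + \<epsilon>\<^sup>2)) = v a \<bullet> v a / 2 - V (sqrt (u a \<bullet> u a + \<epsilon>\<^sup>2))"
proof -
  define f where "f t = v t \<bullet> v t / 2 - V (sqrt (u t \<bullet> u t + \<epsilon>\<^sup>2))" for t
  have d: "(f has_real_derivative 0) (at t within {a..b})" if t: "t \<in> {a..b}" for t
  proof -
    note m = central_motionD[OF assms(2) t]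
    have 1: "((\<lambda>t. u t \<bullet> u t + \<epsilon>\<^sup>2) has_real_derivative (u t \<bullet> v t + v t \<bullet> u t)) (at t within {a..b})"
      by (rule derivative_eq_intros inner_has_real_derivative m refl)+ simp
    have 2: "((\<lambda>t. V (sqrt (u t \<bullet> u t + \<epsilon>\<^sup>2))) has_real_derivative
        force_coeff V (u t \<bullet> u t + \<epsilon>\<^sup>2) / 2 * (u t \<bullet> v t + v t \<bullet> u t)) (at t within {a..b})"
      by (rule DERIV_chain2[OF potential_sqrt_derivative[OF assms(1) m(1)] 1])
    show ?thesis
      unfolding f_def[abs_def]
      by (rule DERIV_cong[OF DERIV_diff[OF DERIV_cdivide[OF inner_has_real_derivative[OF m(3) m(3)]] 2]])
        (simp add: inner_commute field_simps)
  qed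
  have "f a + 0 * (b - a) \<le> f b"
    by (rule nondecreasing_within[OF assms(3)]) (use d in auto)
  moreover have "- f a + 0 * (b - a) \<le> - f b"
    by (rule nondecreasing_within[OF assms(3), of "\<lambda>t. - f t" "\<lambda>_. 0"])
      (auto intro!: derivative_eq_intros d)
  ultimately show ?thesis by (simp add: f_def)
qed

text \<open>The conserved quantity is the squared angular momentum, written without reference to the
  dimension.\<close>

lemma central_motion_angular_momentum:
  assumes "central_motion V \<epsilon> {a..b} u v" "a \<le> b"
  shows "(u b \<bullet> u b) * (v b \<bullet> v b) - (u b \<bullet> v b)\<^sup>2 = (u a \<bullet> u a) * (v a \<bullet> v a) - (u a \<bullet> v a)\<^sup>2"
proof -
  define f where "f t = (u t \<bullet> u t) * (v t \<bullet> v t) - (u t \<bullet> v t)\<^sup>2" for t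
  have d: "(f has_real_derivative 0) (at t within {a..b})" if t: "t \<in> {a..b}" for t
  proof -
    note m = central_motionD[OF assms(1) t]
    show ?thesis
      unfolding f_def[abs_def]
      by (rule derivative_eq_intros inner_has_real_derivative m refl)+
        (simp add: inner_commute algebra_simps)
  qed
  have "f a + 0 * (b - a) \<le> f b"
    by (rule nondecreasing_within[OF assms(2)]) (use d in auto)
  moreover have "- f a + 0 * (b - a) \<le> - f b"
    by (rule nondecreasing_within[OF assms(2), of "\<lambda>t. - f t" "\<lambda>_. 0"])
      (auto intro!: derivative_eq_intros d)
  ultimately show ?thesis by (simp add: f_def)
qed

section \<open>Uniqueness, symmetries and continuous dependence\<close>

lemma central_motion_range:
  assumes "central_motion V \<epsilon> {a..b} u v"
  obtains m M where "0 < m" "\<And>t. t \<in> {a..b} \<Longrightarrow> u t \<bullet> u t + \<epsilon>\<^sup>2 \<in> {m..M}"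
proof (cases "a \<le> b")
  case True
  have c: "continuous_on {a..b} (\<lambda>t. u t \<bullet> u t + \<epsilon>\<^sup>2)"
    by (intro continuous_intros central_motion_continuous[OF assms])
  from continuous_attains_inf[OF compact_Icc _ c] True
  obtain t0 where t0: "t0 \<in> {a..b}" "\<And>t. t \<in> {a..b} \<Longrightarrow> u t0 \<bullet> u t0 + \<epsilon>\<^sup>2 \<le> u t \<bullet> u t + \<epsilon>\<^sup>2" by auto
  from continuous_attains_sup[OF compact_Icc _ c] True
  obtain t1 where t1: "t1 \<in> {a..b}" "\<And>t. t \<in> {a..b} \<Longrightarrow> u t \<bullet> u t + \<epsilon>\<^sup>2 \<le> u t1 \<bullet> u t1 + \<epsilon>\<^sup>2" by auto
  show ?thesis
    by (rule that[of "u t0 \<bullet> u t0 + \<epsilon>\<^sup>2" "u t1 \<bullet> u t1 + \<epsilon>\<^sup>2"])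
      (use t0 t1 central_motionD(1)[OF assms t0(1)] in auto)
next
  case False
  then show ?thesis by (intro that[of 1 1]) auto
qed

text \<open>Gronwall with equal parameters and equal initial states has right-hand side 0; the
  common range of \<sigma> comes from compactness.\<close>

lemma central_motion_unique:
  assumes "smooth_pos V" "central_motion V \<epsilon> {a..b} u v" "central_motion V \<epsilon> {a..b} w z"
    and "u a = w a" "v a = z a" "t \<in> {a..b}"
  shows "u t = w t" "v t = z t"
proof -
  obtain m1 M1 where 1: "0 < m1" "\<And>t. t \<in> {a..b} \<Longrightarrow> u t \<bullet> u t + \<epsilon>\<^sup>2 \<in> {m1..M1}"
    using central_motion_range[OF assms(2)] by blast
  obtain m2 M2 where 2: "0 < m2" "\<And>t. t \<in> {a..b} \<Longrightarrow> w t \<bullet> w t + \<epsilon>\<^sup>2 \<in> {m2..M2}"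
    using central_motion_range[OF assms(3)] by blast
  have "0 < min m1 m2" using 1 2 by simp
  from central_motion_gronwall[OF assms(1) this, of "max M1 M2"]
  obtain C where C: "\<And>a b \<epsilon> \<epsilon>' (u::real \<Rightarrow> 'a) v w z. a \<le> b \<Longrightarrow>
      central_motion V \<epsilon> {a..b} u v \<Longrightarrow> central_motion V \<epsilon>' {a..b} w z \<Longrightarrow>
      (\<And>t. t \<in> {a..b} \<Longrightarrow> u t \<bullet> u t + \<epsilon>\<^sup>2 \<in> {min m1 m2..max M1 M2} \<and> w t \<bullet> w t + \<epsilon>'\<^sup>2 \<in> {min m1 m2..max M1 M2}) \<Longrightarrow>
      (norm (u b - w b))\<^sup>2 + (norm (v b - z b))\<^sup>2 + (\<epsilon>\<^sup>2 - \<epsilon>'\<^sup>2)\<^sup>2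
       \<le> ((norm (u a - w a))\<^sup>2 + (norm (v a - z a))\<^sup>2 + (\<epsilon>\<^sup>2 - \<epsilon>'\<^sup>2)\<^sup>2) * exp (C * (b - a))" by blast
  have sub: "{a..t} \<subseteq> {a..b}" using assms(6) by auto
  have "(norm (u t - w t))\<^sup>2 + (norm (v t - z t))\<^sup>2 + (\<epsilon>\<^sup>2 - \<epsilon>\<^sup>2)\<^sup>2 \<le>
     ((norm (u a - w a))\<^sup>2 + (norm (v a - z a))\<^sup>2 + (\<epsilon>\<^sup>2 - \<epsilon>\<^sup>2)\<^sup>2) * exp (C * (t - a))"
    by (rule C[OF _ central_motion_subset[OF assms(2) sub] central_motion_subset[OF assms(3) sub]])
      (use assms(6) 1(2) 2(2) in force)+
  then have "(norm (u t - w t))\<^sup>2 + (norm (v t - z t))\<^sup>2 \<le> 0" using assms(4,5) by simp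
  then show "u t = w t" "v t = z t"
    by (simp_all add: sum_power2_le_zero_iff)
qed

text \<open>A linear isometry commutes with the force, and time reversal preserves second
  derivatives. It is applied with the reflection at a pericentre and with
  \<open>uminus\<close>.\<close>

lemma central_motion_reflect:
  fixes R :: "'a::real_inner \<Rightarrow> 'a"
  assumes "central_motion V \<epsilon> I u v" and R: "bounded_linear R" "\<And>x. R x \<bullet> R x = x \<bullet> x"
    and J: "\<And>t. t \<in> J \<Longrightarrow> c - t \<in> I"
  shows "central_motion V \<epsilon> J (\<lambda>t. R (u (c - t))) (\<lambda>t. - R (v (c - t)))"
  unfolding central_motion_def
proof (intro ballI conjI)
  fix t assume t: "t \<in> J"
  note m = central_motionD[OF assms(1) J[OF t]]
  show "0 < R (u (c - t)) \<bullet> R (u (c - t)) + \<epsilon>\<^sup>2" using m(1) by (simp add: R)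
  have c: "((\<lambda>t. c - t) has_vector_derivative - 1) (at t within J)"
    by (rule derivative_eq_intros refl)+ simp
  have im: "(\<lambda>t. c - t) ` J \<subseteq> I" using J by auto
  have "((\<lambda>t. u (c - t)) has_vector_derivative (- 1) *\<^sub>R v (c - t)) (at t within J)"
    using vector_diff_chain_within[OF c has_vector_derivative_within_subset[OF m(2) im]] by (simp add: o_def)
  from bounded_linear.has_vector_derivative[OF R(1) this]
  show "((\<lambda>t. R (u (c - t))) has_vector_derivative - R (v (c - t))) (at t within J)"
    by (simp add: linear_neg[OF bounded_linear.linear[OF R(1)]])
  have "((\<lambda>t. v (c - t)) has_vector_derivative (- 1) *\<^sub>R (force_coeff V (u (c - t) \<bullet> u (c - t) + \<epsilon>\<^sup>2) *\<^sub>R u (c - t))) (at t within J)"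
    using vector_diff_chain_within[OF c has_vector_derivative_within_subset[OF m(3) im]] by (simp add: o_def)
  from has_vector_derivative_minus[OF bounded_linear.has_vector_derivative[OF R(1) this]]
  show "((\<lambda>t. - R (v (c - t))) has_vector_derivative
         force_coeff V (R (u (c - t)) \<bullet> R (u (c - t)) + \<epsilon>\<^sup>2) *\<^sub>R R (u (c - t))) (at t within J)"
    by (simp add: linear_neg[OF bounded_linear.linear[OF R(1)]] linear_scale[OF bounded_linear.linear[OF R(1)]] R)
qed

text \<open>\<open>c\<close> is the infimum of the closed set where f \<ge> k. The bound up to and
  including \<open>c\<close> is what continuation arguments use: an estimate valid as long as f
  \<le> k applies at \<open>c\<close> and contradicts f c = k. A pericentre is found in the same
  way.\<close>

lemma first_hitting_time:
  fixes f :: "real \<Rightarrow> real"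
  assumes f: "continuous_on {a..b} f" and "f a \<le> k" "t \<in> {a..b}" "k \<le> f t"
  obtains c where "c \<in> {a..t}" "f c = k" "\<And>s. s \<in> {a..c} \<Longrightarrow> f s \<le> k"
proof -
  define A where "A = {s \<in> {a..t}. k \<le> f s}"
  have "continuous_on {a..t} f" using assms(1,3) by (auto elim: continuous_on_subset)
  then have "closed A" unfolding A_def
    by (intro continuous_on_closed_Collect_le continuous_intros) auto
  moreover have "t \<in> A" using assms by (auto simp: A_def)
  moreover have bdd: "bdd_below A" by (auto simp: A_def intro!: bdd_belowI[of _ a])
  ultimately have c: "Inf A \<in> A" using closed_contains_Inf[of A] by auto
  have before: "f s < k" if "a \<le> s" "s < Inf A" for s
  proof (rule ccontr)
    assume "\<not> f s < k"
    then have "s \<in> A" using that c by (auto simp: A_def)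
    then show False using cInf_lower[OF _ bdd] that by fastforce
  qed
  have "continuous_on {a..Inf A} f"
    using f by (rule continuous_on_subset) (use c assms(3) in \<open>auto simp: A_def\<close>)
  then obtain x where x: "a \<le> x" "x \<le> Inf A" "f x = k"
    using IVT'[of f a k "Inf A"] assms(2) c by (auto simp: A_def)
  then have xA: "x = Inf A" using before[of x] by force
  show ?thesis
  proof (rule that[of x])
    show "x \<in> {a..t}" using c xA by (simp add: A_def)
    fix s assume "s \<in> {a..x}"
    then show "f s \<le> k" using before[of s] x(3) xA by (cases "s = x") auto
  qed (fact x(3))
qed

text \<open>A bootstrap: Gronwall needs \<sigma> bounded away from 0 uniformly in \<epsilon>, which
  holds while u stays within r of w, and its conclusion is strictly better than that, so the
  distance never reaches r. The end \<open>c\<close> is free and \<open>d\<close> does not depend on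
  it, because the nearby motion need not exist up to \<open>b\<close>.\<close>

lemma central_motion_continuous_dependence:
  fixes w z :: "real \<Rightarrow> 'a::real_inner"
  assumes V: "smooth_pos V" and wz: "central_motion V 0 {a..b} w z" and "0 < e"
  obtains d where "0 < d" "d \<le> 1"
    "\<And>\<epsilon> u v c t. 0 \<le> \<epsilon> \<Longrightarrow> \<epsilon> < d \<Longrightarrow> c \<le> b \<Longrightarrow> central_motion V \<epsilon> {a..c} u v \<Longrightarrow>
       dist (u a) (w a) < d \<Longrightarrow> dist (v a) (z a) < d \<Longrightarrow> t \<in> {a..c} \<Longrightarrow>
       dist (u t) (w t) < e \<and> dist (v t) (z t) < e"
proof -
  obtain m M where mM: "0 < m" "\<And>t. t \<in> {a..b} \<Longrightarrow> w t \<bullet> w t \<in> {m..M}"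
    using central_motion_range[OF wz] by auto
  \<comment> \<open>Half a lower bound of |w|: then |u - w| \<le> r leaves |u| \<ge> r, that is u
    \<bullet> u \<ge> m / 4.\<close>
  define r where "r = sqrt m / 2"
  have r: "0 < r" using mM by (simp add: r_def)
  have rr: "r\<^sup>2 = m / 4" using mM by (simp add: r_def power_divide)
  \<comment> \<open>From (|w| + r)^2 \<le> 2 |w|^2 + 2 r^2, with 1 in reserve for
    \<epsilon>^2.\<close>
  define M' where "M' = 2 * M + 2 * r\<^sup>2 + 1"
  have "0 < m / 4" using mM by simp
  from central_motion_gronwall[OF V this, of M']
  obtain C where C: "\<And>a b \<epsilon> \<epsilon>' (u::real \<Rightarrow> 'a) v w z. a \<le> b \<Longrightarrow>
      central_motion V \<epsilon> {a..b} u v \<Longrightarrow> central_motion V \<epsilon>' {a..b} w z \<Longrightarrow>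
      (\<And>t. t \<in> {a..b} \<Longrightarrow> u t \<bullet> u t + \<epsilon>\<^sup>2 \<in> {m / 4..M'} \<and> w t \<bullet> w t + \<epsilon>'\<^sup>2 \<in> {m / 4..M'}) \<Longrightarrow>
      (norm (u b - w b))\<^sup>2 + (norm (v b - z b))\<^sup>2 + (\<epsilon>\<^sup>2 - \<epsilon>'\<^sup>2)\<^sup>2
       \<le> ((norm (u a - w a))\<^sup>2 + (norm (v a - z a))\<^sup>2 + (\<epsilon>\<^sup>2 - \<epsilon>'\<^sup>2)\<^sup>2) * exp (C * (b - a))" by blast
  define k where "k = min r e"
  define E where "E = exp (\<bar>C\<bar> * \<bar>b - a\<bar>)"
  have k: "0 < k" "k \<le> r" "k \<le> e" using r assms(3) by (auto simp: k_def)
  have E1: "1 \<le> E" by (simp add: E_def)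
  \<comment> \<open>Each of the three initial terms is at most d^2, the third because \<epsilon>^2
    \<le> \<epsilon> < d; Gronwall multiplies them by at most E. The choice gives 3 d^2 E <
    k^2.\<close>
  define d where "d = min 1 (k / (2 * E))"
  have d: "0 < d" "d \<le> 1" using k E1 by (auto simp: d_def)
  have "d \<le> k / (2 * E)" by (simp add: d_def)
  then have "d\<^sup>2 \<le> (k / (2 * E))\<^sup>2" using d by (intro power_mono) auto
  then have "4 * d\<^sup>2 * E\<^sup>2 \<le> k\<^sup>2"
    using E1 by (simp add: power_divide power_mult_distrib field_simps)
  moreover have "E \<le> E\<^sup>2" using E1 by (simp add: power2_eq_square)
  then have "4 * d\<^sup>2 * E \<le> 4 * d\<^sup>2 * E\<^sup>2" by (intro mult_left_mono) auto
  moreover have "0 < d\<^sup>2 * E" using d E1 by simp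
  ultimately have dE: "3 * d\<^sup>2 * E < k\<^sup>2" by linarith
  have "k / (2 * E) \<le> k / 1" using k E1 by (intro divide_left_mono) auto
  then have dk: "d \<le> k" using \<open>d \<le> k / (2 * E)\<close> by simp
  show ?thesis
  proof (rule that[OF d])
    fix \<epsilon> c t and u v :: "real \<Rightarrow> 'a"
    assume eps: "0 \<le> \<epsilon>" "\<epsilon> < d" and c: "c \<le> b" and uv: "central_motion V \<epsilon> {a..c} u v"
      and init: "dist (u a) (w a) < d" "dist (v a) (z a) < d" and t: "t \<in> {a..c}"
    have *: "(norm (u s - w s))\<^sup>2 + (norm (v s - z s))\<^sup>2 < k\<^sup>2"
      if s: "s \<in> {a..c}" and le: "\<And>x. x \<in> {a..s} \<Longrightarrow> norm (u x - w x) \<le> r" for s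
    proof -
      have "(norm (u s - w s))\<^sup>2 + (norm (v s - z s))\<^sup>2 + (\<epsilon>\<^sup>2 - 0\<^sup>2)\<^sup>2
       \<le> ((norm (u a - w a))\<^sup>2 + (norm (v a - z a))\<^sup>2 + (\<epsilon>\<^sup>2 - 0\<^sup>2)\<^sup>2) * exp (C * (s - a))"
      proof (rule C)
        show "a \<le> s" using s by simp
        show "central_motion V \<epsilon> {a..s} u v" "central_motion V 0 {a..s} w z"
          using s c by (auto intro: central_motion_subset[OF uv] central_motion_subset[OF wz])
        fix x assume x: "x \<in> {a..s}"
        have wx: "w x \<bullet> w x \<in> {m..M}" using mM(2) x s c by auto
        have "sqrt m \<le> norm (w x)" unfolding norm_eq_sqrt_inner using wx by simp
        moreover have "norm (w x) \<le> norm (u x) + norm (u x - w x)"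
          by (metis norm_minus_commute norm_triangle_sub)
        ultimately have "r \<le> norm (u x)" using le[OF x] by (simp add: r_def)
        then have "r\<^sup>2 \<le> (norm (u x))\<^sup>2" using r by (intro power_mono) auto
        then have 1: "m / 4 \<le> u x \<bullet> u x" by (simp add: rr power2_norm_eq_inner)
        have "norm (u x) \<le> norm (w x) + r" using le[OF x] norm_triangle_sub[of "u x" "w x"] by linarith
        then have "(norm (u x))\<^sup>2 \<le> (norm (w x) + r)\<^sup>2" by (intro power_mono) auto
        also have "\<dots> \<le> 2 * (norm (w x))\<^sup>2 + 2 * r\<^sup>2"
          using sum_squares_bound[of "norm (w x)" r] by (simp add: power2_sum)
        finally have 2: "u x \<bullet> u x \<le> 2 * M + 2 * r\<^sup>2" using wx by (simp add: power2_norm_eq_inner)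
        have "\<epsilon>\<^sup>2 \<le> 1" using eps d by (simp add: power_le_one)
        then show "u x \<bullet> u x + \<epsilon>\<^sup>2 \<in> {m / 4..M'} \<and> w x \<bullet> w x + 0\<^sup>2 \<in> {m / 4..M'}"
          using 1 2 wx mM(1) zero_le_power2[of r] zero_le_power2[of \<epsilon>]
          unfolding M'_def atLeastAtMost_iff zero_power2 by (intro conjI; linarith)
      qed
      also have "\<dots> \<le> ((norm (u a - w a))\<^sup>2 + (norm (v a - z a))\<^sup>2 + (\<epsilon>\<^sup>2 - 0\<^sup>2)\<^sup>2) * E"
      proof -
        have "C * (s - a) \<le> \<bar>C\<bar> * \<bar>b - a\<bar>" using s c by (intro mult_mono) auto
        then show ?thesis unfolding E_def by (intro mult_left_mono) auto
      qed
      also have "\<dots> \<le> (d\<^sup>2 + d\<^sup>2 + d\<^sup>2) * E"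
      proof -
        have "\<epsilon>\<^sup>2 \<le> \<epsilon>" using eps d by (simp add: power2_eq_square mult_left_le)
        then have "(\<epsilon>\<^sup>2)\<^sup>2 \<le> d\<^sup>2" using eps by (intro power_mono) auto
        moreover have "(norm (u a - w a))\<^sup>2 \<le> d\<^sup>2" "(norm (v a - z a))\<^sup>2 \<le> d\<^sup>2"
          using init by (auto intro!: power_mono simp: dist_norm)
        ultimately show ?thesis using E1 by (intro mult_right_mono) auto
      qed
      also have "\<dots> < k\<^sup>2" using dE by simp
      finally show ?thesis by (smt (verit) zero_le_power2)
    qed
    have small: "norm (u s - w s) < r" if s: "s \<in> {a..c}" for s
    proof (rule ccontr)
      assume "\<not> norm (u s - w s) < r"
      moreover have "continuous_on {a..c} (\<lambda>s. norm (u s - w s))"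
        using c by (intro continuous_intros central_motion_continuous[OF uv]
            central_motion_continuous[OF central_motion_subset[OF wz]]) auto
      moreover have "norm (u a - w a) \<le> r" using init(1) k dk by (simp add: dist_norm)
      ultimately obtain x where x: "x \<in> {a..s}" "norm (u x - w x) = r"
          "\<And>y. y \<in> {a..x} \<Longrightarrow> norm (u y - w y) \<le> r"
        using first_hitting_time[of a c "\<lambda>s. norm (u s - w s)" r s] s by auto
      have "(norm (u x - w x))\<^sup>2 + (norm (v x - z x))\<^sup>2 < k\<^sup>2"
        using *[of x] x s by auto
      then have "(norm (u x - w x))\<^sup>2 < r\<^sup>2" using k
        by (smt (verit) power_mono zero_le_power2)
      then show False using x(2) r by (smt (verit) power_mono)
    qed
    have "(norm (u t - w t))\<^sup>2 + (norm (v t - z t))\<^sup>2 < k\<^sup>2"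
      using *[OF t] small t by (force intro: less_imp_le)
    then have "(norm (u t - w t))\<^sup>2 < e\<^sup>2" "(norm (v t - z t))\<^sup>2 < e\<^sup>2"
      using k power_mono[of k e 2] by (smt (verit) zero_le_power2)+
    then show "dist (u t) (w t) < e \<and> dist (v t) (z t) < e"
      using assms(3) by (auto simp: dist_norm intro: power_less_imp_less_base[OF _ less_imp_le])
  qed
qed

section \<open>Passage near the centre\<close>

text \<open>Convexity gives \<open>- s V'(s) / 2 \<le> V(s/2) - V(s)\<close>, and the right-hand side is \<open>o(V(s))\<close>
  because \<open>V\<close> varies slowly.\<close>

lemma slowly_varying_deriv:
  assumes V: "V \<in> class_V_star" and S: "admissible_bound V S" and "0 < \<eta>"
  obtains \<rho> where "0 < \<rho>"
    "\<And>s. 0 < s \<Longrightarrow> s \<le> \<rho> \<Longrightarrow> deriv V s < 0 \<and> - (s * deriv V s) \<le> \<eta> * V s \<and> 0 < V s"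
proof -
  have sm: "smooth_pos V" and lim: "filterlim V at_top (at_right 0)"
    and unif: "\<forall>M\<ge>1. uniform_limit {1..M} (\<lambda>l x. V (l * x) / V l) (\<lambda>x. 1) (at_right 0)"
    using V by (auto simp: class_V_star_def class_V_def)
  have "ereal 0 < S" using S by (simp add: admissible_bound_def zero_ereal_def)
  then obtain S0 where S0: "ereal 0 < ereal S0" "ereal S0 < S" using ereal_dense2 by blast
  have sgn: "deriv V x < 0" "0 < deriv (deriv V) x" if "0 < x" "x \<le> S0" for x
  proof -
    have "ereal x < S" using that S0 by (meson ereal_less_eq(3) le_less_trans)
    then show "deriv V x < 0" "0 < deriv (deriv V) x"
      using S that by (auto simp: admissible_bound_def)
  qed
  \<comment> \<open>k \<le> 1/2 gives V(s/2) \<le> 2 V(s), which costs a factor 2; the mean value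
    theorem on [s/2, s] costs another, hence 4k \<le> \<eta>.\<close>
  define k where "k = min (1 / 2) (\<eta> / 4)"
  have k: "0 < k" "k \<le> 1 / 2" "4 * k \<le> \<eta>" using assms(3) by (auto simp: k_def)
  have "\<forall>\<^sub>F l in at_right 0. \<forall>x\<in>{1..2}. dist (V (l * x) / V l) 1 < k"
    using unif[rule_format, of 2] k(1) by (simp add: uniform_limit_iff)
  moreover have "\<forall>\<^sub>F l in at_right 0. 0 < V l"
    using lim by (simp add: filterlim_at_top_dense)
  ultimately have "\<forall>\<^sub>F l in at_right 0. 0 < V l \<and> dist (V (l * 2) / V l) 1 < k"
    by eventually_elim auto
  then obtain b where b: "0 < b" "\<And>l. 0 < l \<Longrightarrow> l < b \<Longrightarrow> 0 < V l \<and> dist (V (l * 2) / V l) 1 < k"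
    by (auto simp: eventually_at_right_field)
  show ?thesis
  proof (rule that[of "min S0 b"])
    show "0 < min S0 b" using S0 b by simp
    fix s assume s: "0 < s" "s \<le> min S0 b"
    have h: "0 < V (s / 2)" "dist (V s / V (s / 2)) 1 < k"
      using b(2)[of "s / 2"] s by auto
    then have "(1 - k) * V (s / 2) < V s"
      by (auto simp: dist_real_def abs_less_iff field_simps)
    then have d: "V (s / 2) - V s \<le> k * V (s / 2)" by (simp add: algebra_simps)
    have "V (s / 2) \<le> 2 * V s"
      using d k(2) h(1) mult_right_mono[OF k(2), of "V (s / 2)"] by linarith
    then have "k * V (s / 2) \<le> k * (2 * V s)" and pos: "0 < V s"
      using k(1) h(1) by (auto intro: mult_left_mono)
    then have d2: "V (s / 2) - V s \<le> 2 * k * V s" using d by simp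
    have "\<exists>\<xi>>s / 2. \<xi> < s \<and> V s - V (s / 2) = (s - s / 2) * deriv V \<xi>"
      using s by (intro MVT2) (auto intro!: smooth_pos_deriv(1)[OF sm])
    then obtain \<xi> where \<xi>: "s / 2 < \<xi>" "\<xi> < s" "V s - V (s / 2) = (s - s / 2) * deriv V \<xi>" by blast
    \<comment> \<open>V' increases, so -V'(s) \<le> -V'(\<xi>), while -s V'(\<xi>) equals 2 (V(s/2)
      - V(s)) by the choice of \<xi>.\<close>
    have "deriv V \<xi> < deriv V s"
    proof (rule DERIV_pos_imp_increasing[OF \<xi>(2)])
      fix x assume x: "\<xi> \<le> x" "x \<le> s"
      then have "0 < x" "x \<le> S0" using \<xi> s by auto
      then show "\<exists>y. DERIV (deriv V) x :> y \<and> 0 < y"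
        using smooth_pos_deriv(2)[OF sm] sgn(2) by blast
    qed
    then have "s * deriv V \<xi> \<le> s * deriv V s" using s by (intro mult_left_mono) auto
    moreover have "s * deriv V \<xi> = 2 * (V s - V (s / 2))" using \<xi>(3) by simp
    moreover have "2 * (V (s / 2) - V s) \<le> 4 * k * V s" using d2 by simp
    ultimately have "- (s * deriv V s) \<le> 4 * k * V s" by simp
    also have "\<dots> \<le> \<eta> * V s" using k(3) pos by (intro mult_right_mono) auto
    finally show "deriv V s < 0 \<and> - (s * deriv V s) \<le> \<eta> * V s \<and> 0 < V s"
      using sgn(1)[of s] s pos by simp
  qed
qed

text \<open>Here x stands for the squared speed, so the third premise says that the energy is at
  most H in absolute value. The property mentions neither \<epsilon> nor the angular momentum, which
  is what makes the passage estimates uniform.\<close>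

definition force_small :: "(real \<Rightarrow> real) \<Rightarrow> real \<Rightarrow> real \<Rightarrow> real \<Rightarrow> bool" where
  "force_small V H \<eta> \<rho> \<longleftrightarrow>
     (\<forall>\<sigma> x. 0 < \<sigma> \<longrightarrow> \<sigma> \<le> \<rho> \<longrightarrow> \<bar>x / 2 - V (sqrt \<sigma>)\<bar> \<le> H \<longrightarrow>
        1 \<le> x \<and> force_coeff V \<sigma> \<le> 0 \<and> - (\<sigma> * force_coeff V \<sigma>) \<le> \<eta> * x)"

lemma force_smallD:
  assumes "force_small V H \<eta> \<rho>" "0 < \<sigma>" "\<sigma> \<le> \<rho>" "\<bar>x / 2 - V (sqrt \<sigma>)\<bar> \<le> H"
  shows "1 \<le> x" "force_coeff V \<sigma> \<le> 0" "- (\<sigma> * force_coeff V \<sigma>) \<le> \<eta> * x"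
  using assms by (auto simp: force_small_def)

text \<open>With s = sqrt \<sigma>, the product of \<sigma> and
  \<open>force_coeff V \<sigma>\<close> is s V'(s). Once V \<ge> 2H the energy bound gives x \<ge>
  2V - 2H \<ge> V, so a bound in terms of V is one in terms of the squared speed.\<close>

lemma force_small_exists:
  assumes V: "V \<in> class_V_star" and S: "admissible_bound V S" and "0 < \<eta>"
  obtains \<rho> where "0 < \<rho>" "force_small V H \<eta> \<rho>"
proof -
  obtain r where r: "0 < r"
    "\<And>s. 0 < s \<Longrightarrow> s \<le> r \<Longrightarrow> deriv V s < 0 \<and> - (s * deriv V s) \<le> \<eta> * V s \<and> 0 < V s"
    using slowly_varying_deriv[OF assms] by blast
  have "filterlim V at_top (at_right 0)"
    using V by (auto simp: class_V_star_def class_V_def)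
  then have "\<forall>\<^sub>F s in at_right 0. max (2 * H) 1 \<le> V s"
    unfolding filterlim_at_top by blast
  then obtain b where b: "0 < b" "\<And>s. 0 < s \<Longrightarrow> s < b \<Longrightarrow> max (2 * H) 1 \<le> V s"
    by (auto simp: eventually_at_right_field)
  define q where "q = min r (b / 2)"
  have q: "0 < q" "q \<le> r" "q < b" using r b by (auto simp: q_def)
  have "force_small V H \<eta> (q\<^sup>2)"
    unfolding force_small_def
  proof (intro allI impI)
    fix \<sigma> x assume s: "0 < \<sigma>" "\<sigma> \<le> q\<^sup>2" and e: "\<bar>x / 2 - V (sqrt \<sigma>)\<bar> \<le> H"
    have "sqrt \<sigma> \<le> q" using s(2) q(1) by (simp add: real_le_lsqrt)
    then have *: "0 < sqrt \<sigma>" "sqrt \<sigma> \<le> r" "sqrt \<sigma> < b" using s q by auto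
    have f: "force_coeff V \<sigma> \<le> 0" "\<sigma> * force_coeff V \<sigma> = sqrt \<sigma> * deriv V (sqrt \<sigma>)"
      using r(2)[OF *(1,2)] s(1) by (auto simp: force_coeff_def divide_nonpos_pos field_simps)
    have x: "V (sqrt \<sigma>) \<le> x" "1 \<le> x" using b(2)[OF *(1,3)] e by linarith+
    have "- (\<sigma> * force_coeff V \<sigma>) \<le> \<eta> * V (sqrt \<sigma>)" using r(2)[OF *(1,2)] f by simp
    also have "\<dots> \<le> \<eta> * x" using x assms(3) by simp
    finally show "1 \<le> x \<and> force_coeff V \<sigma> \<le> 0 \<and> - (\<sigma> * force_coeff V \<sigma>) \<le> \<eta> * x"
      using x f by simp
  qed
  then show ?thesis using that[of "q\<^sup>2"] q by simp
qed

text \<open>As long as the motion goes inward, \<sigma> stays below \<rho>, so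
  \<open>force_small\<close> applies throughout. Attraction makes the speed grow, and u \<bullet> v
  grows at least at rate |v a|^2 / 2, since at most half of v \<bullet> v is lost to the force; it
  starts no lower than -|u a| |v a| and stays nonpositive, so the passage is short.\<close>

lemma inward_passage:
  assumes sm: "smooth_pos V" and fs: "force_small V H \<eta> \<rho>" and \<eta>: "\<eta> \<le> 1 / 2"
    and uv: "central_motion V \<epsilon> {a..b} u v" and ab: "a \<le> b"
    and near: "u a \<bullet> u a + \<epsilon>\<^sup>2 \<le> \<rho>"
    and energy: "\<bar>v a \<bullet> v a / 2 - V (sqrt (u a \<bullet> u a + \<epsilon>\<^sup>2))\<bar> \<le> H"
    and inward: "\<And>t. t \<in> {a..b} \<Longrightarrow> u t \<bullet> v t \<le> 0"
  shows inward_passage_radius: "u b \<bullet> u b \<le> u a \<bullet> u a"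
    and inward_passage_force: "1 \<le> v b \<bullet> v b" "force_coeff V (u b \<bullet> u b + \<epsilon>\<^sup>2) \<le> 0"
        "- ((u b \<bullet> u b) * force_coeff V (u b \<bullet> u b + \<epsilon>\<^sup>2)) \<le> \<eta> * (v b \<bullet> v b)"
    and inward_passage_time: "b - a \<le> 2 * norm (u a)"
proof -
  have rad: "u t \<bullet> u t \<le> u a \<bullet> u a" if t: "t \<in> {a..b}" for t
  proof -
    have sub: "{a..t} \<subseteq> {a..b}" using t by auto
    have "- (u a \<bullet> u a) + 0 * (t - a) \<le> - (u t \<bullet> u t)"
    proof (rule nondecreasing_within)
      show "a \<le> t" using t by simp
      fix s assume s: "s \<in> {a..t}"
      note m = central_motionD[OF central_motion_subset[OF uv sub] s]
      show "((\<lambda>t. - (u t \<bullet> u t)) has_real_derivative - (u s \<bullet> v s + v s \<bullet> u s)) (at s within {a..t})"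
        by (intro derivative_intros inner_has_real_derivative m)
      show "0 \<le> - (u s \<bullet> v s + v s \<bullet> u s)" using inward[of s] s t by (auto simp: inner_commute)
    qed
    then show ?thesis by simp
  qed
  have F: "1 \<le> v t \<bullet> v t \<and> force_coeff V (u t \<bullet> u t + \<epsilon>\<^sup>2) \<le> 0 \<and>
        - ((u t \<bullet> u t) * force_coeff V (u t \<bullet> u t + \<epsilon>\<^sup>2)) \<le> \<eta> * (v t \<bullet> v t)" if t: "t \<in> {a..b}" for t
  proof -
    have en: "\<bar>v t \<bullet> v t / 2 - V (sqrt (u t \<bullet> u t + \<epsilon>\<^sup>2))\<bar> \<le> H"
      using central_motion_energy[OF sm central_motion_subset[OF uv], of a t] t energy by simp
    have "u t \<bullet> u t + \<epsilon>\<^sup>2 \<le> \<rho>" using rad[OF t] near by simp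
    note D = force_smallD[OF fs central_motionD(1)[OF uv t] this en]
    \<comment> \<open>The coefficient is nonpositive and u \<bullet> u \<le> \<sigma>, so the bound
      for \<sigma> carries over to u \<bullet> u.\<close>
    have "(u t \<bullet> u t + \<epsilon>\<^sup>2) * force_coeff V (u t \<bullet> u t + \<epsilon>\<^sup>2) \<le> (u t \<bullet> u t) * force_coeff V (u t \<bullet> u t + \<epsilon>\<^sup>2)"
      using D(2) by (intro mult_right_mono_neg) auto
    then show ?thesis using D by auto
  qed
  show "u b \<bullet> u b \<le> u a \<bullet> u a" using rad ab by simp
  show "1 \<le> v b \<bullet> v b" "force_coeff V (u b \<bullet> u b + \<epsilon>\<^sup>2) \<le> 0"
        "- ((u b \<bullet> u b) * force_coeff V (u b \<bullet> u b + \<epsilon>\<^sup>2)) \<le> \<eta> * (v b \<bullet> v b)"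
    using F[of b] ab by auto
  have speed: "v a \<bullet> v a \<le> v t \<bullet> v t" if t: "t \<in> {a..b}" for t
  proof -
    have sub: "{a..t} \<subseteq> {a..b}" using t by auto
    have "v a \<bullet> v a + 0 * (t - a) \<le> v t \<bullet> v t"
    proof (rule nondecreasing_within)
      show "a \<le> t" using t by simp
      fix s assume s: "s \<in> {a..t}"
      note m = central_motionD[OF central_motion_subset[OF uv sub] s]
      define g where "g = force_coeff V (u s \<bullet> u s + \<epsilon>\<^sup>2)"
      show "((\<lambda>t. v t \<bullet> v t) has_real_derivative (v s \<bullet> (g *\<^sub>R u s) + (g *\<^sub>R u s) \<bullet> v s)) (at s within {a..t})"
        unfolding g_def by (intro inner_has_real_derivative m)
      have "u s \<bullet> v s \<le> 0" "g \<le> 0" using inward[of s] F[of s] s t by (auto simp: g_def)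
      then show "0 \<le> v s \<bullet> (g *\<^sub>R u s) + (g *\<^sub>R u s) \<bullet> v s"
        by (simp add: inner_commute mult_nonpos_nonpos)
    qed
    then show ?thesis by simp
  qed
  define n where "n = norm (v a)"
  have n1: "1 \<le> n" using F[of a] ab by (simp add: n_def norm_eq_sqrt_inner)
  have "u a \<bullet> v a + n\<^sup>2 / 2 * (b - a) \<le> u b \<bullet> v b"
  proof (rule nondecreasing_within[OF ab])
    fix s assume s: "s \<in> {a..b}"
    note m = central_motionD[OF uv s]
    define g where "g = force_coeff V (u s \<bullet> u s + \<epsilon>\<^sup>2)"
    show "((\<lambda>t. u t \<bullet> v t) has_real_derivative (u s \<bullet> (g *\<^sub>R u s) + v s \<bullet> v s)) (at s within {a..b})"
      unfolding g_def by (intro inner_has_real_derivative m)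
    have "\<eta> * (v s \<bullet> v s) \<le> 1 / 2 * (v s \<bullet> v s)" using \<eta> by (intro mult_right_mono) auto
    then show "n\<^sup>2 / 2 \<le> u s \<bullet> (g *\<^sub>R u s) + v s \<bullet> v s"
      using F[OF s] speed[OF s] by (simp add: n_def power2_norm_eq_inner g_def mult.commute)
  qed
  moreover have "u b \<bullet> v b \<le> 0" using inward ab by simp
  moreover have "- (norm (u a) * n) \<le> u a \<bullet> v a"
    unfolding n_def using Cauchy_Schwarz_ineq2[of "u a" "v a"] by linarith
  ultimately have "n * (n * (b - a)) \<le> n * (2 * norm (u a))" by (simp add: power2_eq_square mult_ac)
  then have "n * (b - a) \<le> 2 * norm (u a)" using n1 by simp
  moreover have "1 * (b - a) \<le> n * (b - a)" using n1 ab by (intro mult_right_mono) auto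
  ultimately show "b - a \<le> 2 * norm (u a)" by simp
qed

text \<open>The derivative is g / |v| times the component of u orthogonal to v, whose length is the
  angular momentum divided by |v|.\<close>

lemma direction_has_vector_derivative:
  assumes "central_motion V \<epsilon> I u v" "t \<in> I" "v t \<noteq> 0"
  defines "g \<equiv> force_coeff V (u t \<bullet> u t + \<epsilon>\<^sup>2)"
  shows "((\<lambda>t. sgn (v t)) has_vector_derivative
     (g / norm (v t)) *\<^sub>R u t - (g * (u t \<bullet> v t) / norm (v t) ^ 3) *\<^sub>R v t) (at t within I)" (is ?A)
    and "norm ((g / norm (v t)) *\<^sub>R u t - (g * (u t \<bullet> v t) / norm (v t) ^ 3) *\<^sub>R v t) =
      \<bar>g\<bar> * sqrt ((u t \<bullet> u t) * (v t \<bullet> v t) - (u t \<bullet> v t)\<^sup>2) / (v t \<bullet> v t)" (is ?B)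
proof -
  define X where "X = v t \<bullet> v t"
  define n where "n = norm (v t)"
  have X: "0 < X" using assms(3) by (simp add: X_def)
  have n: "0 < n" "n\<^sup>2 = X" "sqrt X = n"
    using assms(3) by (auto simp: n_def X_def power2_norm_eq_inner norm_eq_sqrt_inner)
  note m = central_motionD[OF assms(1,2), folded g_def]
  have "((\<lambda>t. v t \<bullet> v t) has_real_derivative 2 * g * (u t \<bullet> v t)) (at t within I)"
    by (rule DERIV_cong[OF inner_has_real_derivative[OF m(3) m(3)]]) (simp add: inner_commute)
  from DERIV_chain2[OF DERIV_real_sqrt this] X
  have s: "((\<lambda>t. sqrt (v t \<bullet> v t)) has_real_derivative inverse n / 2 * (2 * g * (u t \<bullet> v t))) (at t within I)"
    by (simp add: X_def[symmetric] n)
  have "((\<lambda>t. inverse (sqrt (v t \<bullet> v t))) has_real_derivative - (g * (u t \<bullet> v t) / n ^ 3)) (at t within I)"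
    by (rule DERIV_cong[OF DERIV_inverse'[OF s]])
      (use n in \<open>auto simp: X_def[symmetric] field_simps power3_eq_cube\<close>)
  from has_vector_derivative_scaleR[OF this m(3)]
  show ?A
    using n by (auto simp: sgn_div_norm norm_eq_sqrt_inner[symmetric] n_def divide_inverse mult.commute)
  define w where "w = (g / n) *\<^sub>R u t - (g * (u t \<bullet> v t) / n ^ 3) *\<^sub>R v t"
  have "w \<bullet> w = g\<^sup>2 * ((u t \<bullet> u t) * X - (u t \<bullet> v t)\<^sup>2) / X\<^sup>2"
    unfolding w_def using n(1)
    by (simp add: inner_diff inner_commute X_def[symmetric] n(2)[symmetric] field_simps power2_eq_square power3_eq_cube)
  then have "sqrt (w \<bullet> w) = \<bar>g\<bar> * sqrt ((u t \<bullet> u t) * X - (u t \<bullet> v t)\<^sup>2) / X"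
    using X by (simp add: real_sqrt_mult real_sqrt_divide)
  then show ?B unfolding norm_eq_sqrt_inner[of "_ - _"] by (simp add: w_def n_def X_def)
qed

text \<open>If \<open>l\<close> is the angular momentum, the velocity direction turns at a rate at most
  \<open>\<eta> l / |u|\<^sup>2\<close>, while \<open>arctan ((u \<bullet> v) / l)\<close>, which varies by at most \<open>\<pi>\<close>, increases at a rate
  at least \<open>l / (2 |u|\<^sup>2)\<close>.\<close>

lemma inward_passage_deflection:
  assumes sm: "smooth_pos V" and fs: "force_small V H \<eta> \<rho>" and \<eta>: "\<eta> \<le> 1 / 2"
    and uv: "central_motion V \<epsilon> {a..b} u v" and ab: "a \<le> b"
    and near: "u a \<bullet> u a + \<epsilon>\<^sup>2 \<le> \<rho>"
    and energy: "\<bar>v a \<bullet> v a / 2 - V (sqrt (u a \<bullet> u a + \<epsilon>\<^sup>2))\<bar> \<le> H"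
    and inward: "\<And>t. t \<in> {a..b} \<Longrightarrow> u t \<bullet> v t \<le> 0"
  shows inward_passage_deflection_bound: "0 \<le> \<eta> \<Longrightarrow> norm (sgn (v b) - sgn (v a)) \<le> 2 * pi * \<eta>"
    and inward_passage_radial: "(u a \<bullet> u a) * (v a \<bullet> v a) = (u a \<bullet> v a)\<^sup>2 \<Longrightarrow> sgn (v b) = sgn (v a)"
proof -
  define l where "l = sqrt ((u a \<bullet> u a) * (v a \<bullet> v a) - (u a \<bullet> v a)\<^sup>2)"
  define g where "g t = force_coeff V (u t \<bullet> u t + \<epsilon>\<^sup>2)" for t
  define e' where "e' t = (g t / norm (v t)) *\<^sub>R u t - (g t * (u t \<bullet> v t) / norm (v t) ^ 3) *\<^sub>R v t" for t
  have l0: "0 \<le> l" unfolding l_def using Cauchy_Schwarz_ineq[of "u a" "v a"] by simp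
  have l2: "l\<^sup>2 = (u a \<bullet> u a) * (v a \<bullet> v a) - (u a \<bullet> v a)\<^sup>2"
    unfolding l_def using Cauchy_Schwarz_ineq[of "u a" "v a"] by simp
  have F: "1 \<le> v t \<bullet> v t" "g t \<le> 0" "- ((u t \<bullet> u t) * g t) \<le> \<eta> * (v t \<bullet> v t)" if t: "t \<in> {a..b}" for t
  proof -
    have "central_motion V \<epsilon> {a..t} u v" "a \<le> t" using t central_motion_subset[OF uv, of "{a..t}"] by auto
    from inward_passage_force[OF sm fs \<eta> this near energy] inward t
    show "1 \<le> v t \<bullet> v t" "g t \<le> 0" "- ((u t \<bullet> u t) * g t) \<le> \<eta> * (v t \<bullet> v t)"
      by (auto simp: g_def)
  qed
  have v0: "v t \<noteq> 0" if "t \<in> {a..b}" for t using F(1)[OF that] by auto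
  have lt: "(u t \<bullet> u t) * (v t \<bullet> v t) - (u t \<bullet> v t)\<^sup>2 = l\<^sup>2" if t: "t \<in> {a..b}" for t
    unfolding l2 by (rule central_motion_angular_momentum[OF central_motion_subset[OF uv]]) (use t in auto)
  have e: "((\<lambda>t. sgn (v t)) has_vector_derivative e' t) (at t within {a..b})" if "t \<in> {a..b}" for t
    unfolding e'_def g_def using direction_has_vector_derivative(1)[OF uv that v0[OF that]] .
  have ne: "norm (e' t) = - g t * l / (v t \<bullet> v t)" if "t \<in> {a..b}" for t
    unfolding e'_def g_def direction_has_vector_derivative(2)[OF uv that v0[OF that]] lt[OF that]
    using l0 F(2)[OF that] by (simp add: g_def)
  \<comment> \<open>2 \<eta> is the ratio of the two rates \<eta> l / |u|^2 and l / (2 |u|^2). For l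
    = 0 division by zero makes \<phi> and \<phi>' vanish, so the same comparison function handles
    the radial case.\<close>
  define \<phi> where "\<phi> t = 2 * \<eta> * arctan ((u t \<bullet> v t) / l)" for t
  define \<phi>' where "\<phi>' t = 2 * \<eta> * (((v t \<bullet> v t + g t * (u t \<bullet> u t)) / l) / (1 + ((u t \<bullet> v t) / l)\<^sup>2))" for t
  have dphi: "(\<phi> has_vector_derivative \<phi>' t) (at t within {a..b})" if t: "t \<in> {a..b}" for t
  proof -
    note m = central_motionD[OF uv t, folded g_def]
    have "((\<lambda>t. (u t \<bullet> v t) / l) has_real_derivative (v t \<bullet> v t + g t * (u t \<bullet> u t)) / l) (at t within {a..b})"
      by (rule DERIV_cong[OF DERIV_cdivide[OF inner_has_real_derivative[OF m(2,3)]]]) simp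
    from DERIV_cmult[OF DERIV_chain2[OF DERIV_arctan this], of "2 * \<eta>"]
    show ?thesis
      unfolding \<phi>_def[abs_def] \<phi>'_def by (simp add: has_real_derivative_iff_has_vector_derivative divide_inverse mult_ac)
  qed
  \<comment> \<open>The two alternatives are the hypotheses available in the two
    conclusions.\<close>
  have le: "norm (e' t) \<le> \<phi>' t" if "l = 0 \<or> 0 \<le> \<eta>" "t \<in> {a..b}" for t
  proof (cases "l = 0")
    case True
    then show ?thesis using ne[OF that(2)] by (simp add: \<phi>'_def)
  next
    case False
    define p X q where "p = u t \<bullet> u t" and "X = v t \<bullet> v t" and "q = u t \<bullet> v t"
    have l: "0 < l" "0 \<le> \<eta>" using False l0 that by auto
    have X: "1 \<le> X" using F(1)[OF that(2)] by (simp add: X_def)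
    \<comment> \<open>Conservation of l, read as Lagrange's identity: up to the factor 2 \<eta> it
      turns the derivative of the arctangent into (X + g p) l / (p X).\<close>
    have pX: "p * X = l\<^sup>2 + q\<^sup>2" using lt[OF that(2)] by (simp add: p_def X_def q_def)
    then have "0 < p * X" using l by (simp add: add_pos_nonneg)
    then have p: "0 < p" using X by (simp add: zero_less_mult_iff)
    have gp: "- (p * g t) \<le> \<eta> * X" using F(3)[OF that(2)] by (simp add: p_def X_def)
    have "\<eta> * X \<le> 1 / 2 * X" using \<eta> X by (intro mult_right_mono) auto
    then have "1 / 2 * X \<le> X + g t * p" using gp by (simp add: mult.commute)
    then have "2 * \<eta> * (1 / 2 * X) \<le> 2 * \<eta> * (X + g t * p)" using l by (intro mult_left_mono) auto
    then have *: "- g t * p \<le> 2 * \<eta> * (X + g t * p)" using gp by (simp add: mult.commute)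
    have sq: "1 + (q / l)\<^sup>2 = (l\<^sup>2 + q\<^sup>2) / l\<^sup>2"
      using l by (simp add: power_divide add_divide_distrib)
    have "\<phi>' t = 2 * \<eta> * ((X + g t * p) * l / (p * X))"
      unfolding \<phi>'_def pX X_def[symmetric] p_def[symmetric] q_def[symmetric]
      unfolding sq using l by (simp add: power2_eq_square)
    also have "\<dots> = (2 * \<eta> * (X + g t * p)) * (l / (p * X))" by simp
    also have "\<dots> \<ge> (- g t * p) * (l / (p * X))"
      using * l p X by (intro mult_right_mono) auto
    finally show ?thesis using ne[OF that(2)] p by (simp add: X_def)
  qed
  have main: "norm (sgn (v b) - sgn (v a)) \<le> \<phi> b - \<phi> a" if "l = 0 \<or> 0 \<le> \<eta>"
  proof (cases "a = b")
    case False
    then have "a < b" using ab by simp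
    then show ?thesis
    proof (rule differentiable_bound_general)
      show "continuous_on {a..b} \<phi>" "continuous_on {a..b} (\<lambda>t. sgn (v t))"
        using dphi e by (meson continuous_on_eq_continuous_within has_vector_derivative_continuous)+
      fix x assume x: "a < x" "x < b"
      then show "(\<phi> has_vector_derivative \<phi>' x) (at x)" 
        using dphi[of x] by (simp add: at_within_Icc_at)
      from x show "((\<lambda>t. sgn (v t)) has_vector_derivative e' x) (at x)"
        using e[of x] by (simp add: at_within_Icc_at)
      from x show "norm (e' x) \<le> \<phi>' x" using le[OF that] by simp
    qed
  qed simp
  show "norm (sgn (v b) - sgn (v a)) \<le> 2 * pi * \<eta>" if "0 \<le> \<eta>"
  proof -
    have "\<phi> b - \<phi> a = 2 * \<eta> * (arctan ((u b \<bullet> v b) / l) - arctan ((u a \<bullet> v a) / l))"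
      by (simp add: \<phi>_def algebra_simps)
    also have "\<dots> \<le> 2 * \<eta> * pi"
      using that arctan_ubound[of "(u b \<bullet> v b) / l"] arctan_lbound[of "(u a \<bullet> v a) / l"]
      by (intro mult_left_mono) auto
    finally show ?thesis using main that by (simp add: mult_ac)
  qed
  show "sgn (v b) = sgn (v a)" if "(u a \<bullet> u a) * (v a \<bullet> v a) = (u a \<bullet> v a)\<^sup>2"
  proof -
    have "l = 0" using that by (simp add: l_def)
    then show ?thesis using main by (simp add: \<phi>_def)
  qed
qed

section \<open>The pericentre and the symmetry about it\<close>

lemma pericenter_exists:
  assumes uv: "central_motion V \<epsilon> {a..b} u v" and "u a \<bullet> v a \<le> 0"
    and "t \<in> {a..b}" "0 < u t \<bullet> v t"
  obtains c where "c \<in> {a..b}" "u c \<bullet> v c = 0" "\<And>s. s \<in> {a..c} \<Longrightarrow> u s \<bullet> v s \<le> 0"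
proof -
  have cont: "continuous_on {a..b} (\<lambda>t. u t \<bullet> v t)"
    by (intro continuous_intros central_motion_continuous[OF uv])
  obtain c where "c \<in> {a..t}" "u c \<bullet> v c = 0" "\<And>s. s \<in> {a..c} \<Longrightarrow> u s \<bullet> v s \<le> 0"
    by (rule first_hitting_time[OF cont assms(2,3) less_imp_le[OF assms(4)]]) (rule that; assumption)
  then show ?thesis using that[of c] assms(3) by auto
qed

text \<open>The Householder reflection with normal e. Since \<open>sgn 0 = 0\<close>, it is the
  identity for \<open>e = 0\<close>.\<close>

lemma reflection_isometry:
  fixes e :: "'a::real_inner"
  shows "bounded_linear (\<lambda>y. y - (2 * (y \<bullet> sgn e)) *\<^sub>R sgn e)"
    and "(y - (2 * (y \<bullet> sgn e)) *\<^sub>R sgn e) \<bullet> (y - (2 * (y \<bullet> sgn e)) *\<^sub>R sgn e) = y \<bullet> y"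
proof -
  have "bounded_linear (\<lambda>y. (2 * (y \<bullet> sgn e)) *\<^sub>R sgn e)"
    by (rule bounded_linear_scaleR_const, rule bounded_linear_const_mult, rule bounded_linear_inner_left)
  then show "bounded_linear (\<lambda>y. y - (2 * (y \<bullet> sgn e)) *\<^sub>R sgn e)"
    by (intro bounded_linear_sub bounded_linear_ident)
  show "(y - (2 * (y \<bullet> sgn e)) *\<^sub>R sgn e) \<bullet> (y - (2 * (y \<bullet> sgn e)) *\<^sub>R sgn e) = y \<bullet> y"
  proof (cases "e = 0")
    case False
    then have "sgn e \<bullet> sgn e = 1" by (simp add: dot_square_norm norm_sgn)
    then show ?thesis
      by (simp add: inner_diff_left inner_diff_right inner_commute[of "sgn e" y])
  qed simp
qed

text \<open>At the pericentre the position lies in the mirror and the velocity is normal to it, so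
  the reflected reversal passes through the same state at \<open>c\<close> and uniqueness applies.
  The mirror time \<open>2 * c - t\<close> has to lie in the interval of the given motion.\<close>

lemma pericenter_reflection:
  assumes sm: "smooth_pos V" and uv: "central_motion V \<epsilon> {a..b} u v"
    and c: "c \<in> {a..b}" "u c \<bullet> v c = 0" "v c \<noteq> 0" and t: "t \<in> {c..b}" "a \<le> 2 * c - t"
  defines "R \<equiv> \<lambda>y. y - (2 * (y \<bullet> sgn (v c))) *\<^sub>R sgn (v c)"
  shows "u t = R (u (2 * c - t))" "v t = - R (v (2 * c - t))"
proof -
  have 1: "central_motion V \<epsilon> {c..t} u v" using c t by (intro central_motion_subset[OF uv]) auto
  have 2: "central_motion V \<epsilon> {c..t} (\<lambda>t. R (u (2 * c - t))) (\<lambda>t. - R (v (2 * c - t)))"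
    by (rule central_motion_reflect[OF uv]) (use c t in \<open>auto simp: R_def reflection_isometry\<close>)
  have "R (u c) = u c" using c(2) by (simp add: R_def sgn_div_norm)
  moreover have "R (v c) = - v c"
  proof -
    have "(v c \<bullet> sgn (v c)) *\<^sub>R sgn (v c) = v c"
      using c(3) by (simp add: sgn_div_norm power2_norm_eq_inner[symmetric] power2_eq_square field_simps)
    then have "(2 * (v c \<bullet> sgn (v c))) *\<^sub>R sgn (v c) = 2 *\<^sub>R v c" by (metis scaleR_scaleR)
    then show ?thesis by (simp add: R_def scaleR_2)
  qed
  ultimately show "u t = R (u (2 * c - t))" "v t = - R (v (2 * c - t))"
    using central_motion_unique[OF sm 1 2, of t] t by auto
qed

section \<open>Collision orbits\<close>

text \<open>With \<eta> = 1/2 the derivative V + s V' of s V(s) is at least V / 2, so s V(s) is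
  nondecreasing near 0 and bounded by its value at the right end.\<close>

lemma slowly_varying_mult_bounded:
  assumes V: "V \<in> class_V_star" and S: "admissible_bound V S"
  obtains r B where "0 < r" "\<And>s. 0 < s \<Longrightarrow> s \<le> r \<Longrightarrow> s * V s \<le> B"
proof -
  have sm: "smooth_pos V" using V by (auto simp: class_V_star_def class_V_def)
  obtain r where r: "0 < r"
    "\<And>s. 0 < s \<Longrightarrow> s \<le> r \<Longrightarrow> deriv V s < 0 \<and> - (s * deriv V s) \<le> 1 / 2 * V s \<and> 0 < V s"
    using slowly_varying_deriv[OF V S, of "1 / 2"] by (metis half_gt_zero_iff zero_less_one)
  have "s * V s \<le> r * V r" if s: "0 < s" "s \<le> r" for s
  proof (rule DERIV_nonneg_imp_nondecreasing[OF s(2)])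
    fix x assume x: "s \<le> x" "x \<le> r"
    then have "DERIV (\<lambda>s. s * V s) x :> V x + x * deriv V x"
      using s by (auto intro!: derivative_eq_intros smooth_pos_deriv(1)[OF sm])
    moreover have "0 \<le> V x + x * deriv V x" using r(2)[of x] x s by auto
    ultimately show "\<exists>y. DERIV (\<lambda>s. s * V s) x :> y \<and> 0 \<le> y" by blast
  qed
  then show ?thesis using that r(1) by blast
qed

text \<open>Since \<open>s\<^sup>2 V(s) \<rightarrow> 0\<close>, energy conservation leaves no room for a nonzero angular momentum.\<close>

lemma collision_orbit_radial:
  fixes w z :: "real \<Rightarrow> 'a::real_inner"
  assumes V: "V \<in> class_V_star" and S: "admissible_bound V S"
    and wz: "central_motion V 0 {0..<T} w z" and T: "0 < T" and lim: "(w \<longlongrightarrow> 0) (at_left T)"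
  obtains t0 e where "0 \<le> t0" "t0 < T" "norm e = 1"
    "\<And>t. t0 \<le> t \<Longrightarrow> t < T \<Longrightarrow> z t \<noteq> 0 \<and> sgn (z t) = e \<and> w t = - norm (w t) *\<^sub>R e \<and> w t \<bullet> z t < 0"
proof -
  have sm: "smooth_pos V" using V by (auto simp: class_V_star_def class_V_def)
  define h where "h = z 0 \<bullet> z 0 / 2 - V (sqrt (w 0 \<bullet> w 0 + 0\<^sup>2))"
  define H where "H = \<bar>h\<bar>"
  have "0 < (1 / 2 :: real)" by simp
  from force_small_exists[OF V S this, of H]
  obtain \<rho> where \<rho>: "0 < \<rho>" "force_small V H (1 / 2) \<rho>" by blast
  have lim2: "((\<lambda>t. w t \<bullet> w t) \<longlongrightarrow> 0) (at_left T)"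
    using tendsto_inner[OF lim lim] by simp
  have "\<forall>\<^sub>F t in at_left T. w t \<bullet> w t < \<rho>" using order_tendstoD(2)[OF lim2 \<rho>(1)] .
  then obtain b where b: "b < T" "\<And>t. b < t \<Longrightarrow> t < T \<Longrightarrow> w t \<bullet> w t < \<rho>"
    by (auto simp: eventually_at_left_field)
  define t0 where "t0 = max 0 ((b + T) / 2)"
  have t0: "0 \<le> t0" "t0 < T" "b < t0" using b T by (auto simp: t0_def less_max_iff_disj)
  have sub: "central_motion V 0 {s..t} w z" if "0 \<le> s" "t < T" for s t
    using that by (intro central_motion_subset[OF wz]) auto
  have energy: "z t \<bullet> z t / 2 - V (sqrt (w t \<bullet> w t + 0\<^sup>2)) = h" if "0 \<le> t" "t < T" for t
    using central_motion_energy[OF sm sub[of 0 t]] that by (simp add: h_def)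
  have F: "1 \<le> z t \<bullet> z t" "- ((w t \<bullet> w t) * force_coeff V (w t \<bullet> w t)) \<le> 1 / 2 * (z t \<bullet> z t)"
    and near: "w t \<bullet> w t + 0\<^sup>2 \<le> \<rho>" and nz: "0 < w t \<bullet> w t" if t: "t0 \<le> t" "t < T" for t
  proof -
    show "0 < w t \<bullet> w t" using central_motionD(1)[OF wz, of t] t t0 by simp
    moreover have "w t \<bullet> w t \<le> \<rho>" using b(2)[of t] t t0 by simp
    moreover have "\<bar>z t \<bullet> z t / 2 - V (sqrt (w t \<bullet> w t))\<bar> \<le> H" using energy[of t] t t0 by (simp add: H_def)
    ultimately show "1 \<le> z t \<bullet> z t" "- ((w t \<bullet> w t) * force_coeff V (w t \<bullet> w t)) \<le> 1 / 2 * (z t \<bullet> z t)"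
      "w t \<bullet> w t + 0\<^sup>2 \<le> \<rho>"
      using force_smallD[OF \<rho>(2), of "w t \<bullet> w t" "z t \<bullet> z t"] by auto
  qed
  \<comment> \<open>Once w \<bullet> z is nonnegative it remains so, its derivative being at least
    half the squared speed; the distance from the centre then cannot tend to 0.\<close>
  have inward: "w t1 \<bullet> z t1 < 0" if t1: "t0 \<le> t1" "t1 < T" for t1
  proof (rule ccontr)
    assume "\<not> w t1 \<bullet> z t1 < 0"
    then have pos1: "0 \<le> w t1 \<bullet> z t1" by simp
    have out: "0 \<le> w t \<bullet> z t" if t: "t1 \<le> t" "t < T" for t
    proof -
      have "w t1 \<bullet> z t1 + 0 * (t - t1) \<le> w t \<bullet> z t"
      proof (rule nondecreasing_within[OF t(1)])
        fix s assume s: "s \<in> {t1..t}"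
        have "central_motion V 0 {t1..t} w z" using t t1 t0 by (intro sub) auto
        note m = central_motionD[OF this s]
        show "((\<lambda>t. w t \<bullet> z t) has_real_derivative
            (w s \<bullet> (force_coeff V (w s \<bullet> w s + 0\<^sup>2) *\<^sub>R w s) + z s \<bullet> z s)) (at s within {t1..t})"
          by (intro inner_has_real_derivative m)
        show "0 \<le> w s \<bullet> (force_coeff V (w s \<bullet> w s + 0\<^sup>2) *\<^sub>R w s) + z s \<bullet> z s"
          using F[of s] s t t1 by (simp add: mult.commute)
      qed
      then show ?thesis using pos1 by simp
    qed
    have "w t1 \<bullet> w t1 \<le> w t \<bullet> w t" if t: "t1 < t" "t < T" for t
    proof -
      have "w t1 \<bullet> w t1 + 0 * (t - t1) \<le> w t \<bullet> w t"
      proof (rule nondecreasing_within)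
        show "t1 \<le> t" using t by simp
        fix s assume s: "s \<in> {t1..t}"
        have "central_motion V 0 {t1..t} w z" using t t1 t0 by (intro sub) auto
        note m = central_motionD[OF this s]
        show "((\<lambda>t. w t \<bullet> w t) has_real_derivative (w s \<bullet> z s + z s \<bullet> w s)) (at s within {t1..t})"
          by (intro inner_has_real_derivative m)
        show "0 \<le> w s \<bullet> z s + z s \<bullet> w s" using out[of s] s t by (simp add: inner_commute)
      qed
      then show ?thesis by simp
    qed
    then have "\<forall>\<^sub>F t in at_left T. w t1 \<bullet> w t1 \<le> w t \<bullet> w t"
      using t1 by (auto simp: eventually_at_left_field)
    from tendsto_lowerbound[OF lim2 this] nz[OF t1] show False by (simp add: trivial_limit_at_left_real)
  qed
  have L: "(w t0 \<bullet> w t0) * (z t0 \<bullet> z t0) - (w t0 \<bullet> z t0)\<^sup>2 \<le> 0"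
  proof -
    obtain r B where rB: "0 < r" "\<And>s. 0 < s \<Longrightarrow> s \<le> r \<Longrightarrow> s * V s \<le> B"
      using slowly_varying_mult_bounded[OF V S] by blast
    \<comment> \<open>The squared angular momentum is at most |w|^2 |z|^2 = 2 |w|^2 (h + V(|w|)),
      and |w| V(|w|) \<le> B bounds this by f, which tends to 0.\<close>
    define f where "f t = 2 * H * (norm (w t))\<^sup>2 + 2 * B * norm (w t)" for t
    have lf: "(f \<longlongrightarrow> 2 * H * (norm (0::'a))\<^sup>2 + 2 * B * norm (0::'a)) (at_left T)"
      unfolding f_def[abs_def] by (intro tendsto_intros lim)
    have "\<forall>\<^sub>F t in at_left T. norm (w t) < r"
      using order_tendstoD(2)[OF tendsto_norm[OF lim], of r] rB by simp
    moreover have "\<forall>\<^sub>F t in at_left T. t0 < t" "\<forall>\<^sub>F t in at_left T. t < T"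
      using t0 by (auto simp: eventually_at_left_field)
    ultimately have "\<forall>\<^sub>F t in at_left T. (w t0 \<bullet> w t0) * (z t0 \<bullet> z t0) - (w t0 \<bullet> z t0)\<^sup>2 \<le> f t"
    proof eventually_elim
      case (elim t)
      have n: "0 < norm (w t)" using nz[of t] elim by auto
      have e: "z t \<bullet> z t = 2 * (h + V (norm (w t)))"
        using energy[of t] elim t0 by (simp add: norm_eq_sqrt_inner)
      have "(w t0 \<bullet> w t0) * (z t0 \<bullet> z t0) - (w t0 \<bullet> z t0)\<^sup>2 = (w t \<bullet> w t) * (z t \<bullet> z t) - (w t \<bullet> z t)\<^sup>2"
        using central_motion_angular_momentum[OF sub[of t0 t]] elim t0 by simp
      also have "\<dots> \<le> (norm (w t))\<^sup>2 * (2 * (h + V (norm (w t))))"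
        by (simp add: e power2_norm_eq_inner)
      also have "\<dots> = 2 * h * (norm (w t))\<^sup>2 + 2 * (norm (w t) * V (norm (w t))) * norm (w t)"
        by (simp add: algebra_simps power2_eq_square)
      also have "\<dots> \<le> f t"
        unfolding f_def H_def using rB(2)[of "norm (w t)"] n elim
        by (intro add_mono mult_right_mono mult_left_mono) auto
      finally show ?case .
    qed
    from tendsto_lowerbound[OF lf this] show ?thesis by (simp add: trivial_limit_at_left_real)
  qed
  have L0: "(w t0 \<bullet> w t0) * (z t0 \<bullet> z t0) = (w t0 \<bullet> z t0)\<^sup>2"
    using L Cauchy_Schwarz_ineq[of "w t0" "z t0"] by simp
  show ?thesis
  proof (rule that[OF t0(1,2), of "sgn (z t0)"])
    show "norm (sgn (z t0)) = 1" using F(1)[of t0] t0 by (auto simp: norm_sgn)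
    fix t assume t: "t0 \<le> t" "t < T"
    have s: "central_motion V 0 {t0..t} w z" using t t0 by (intro sub) auto
    have z0: "z t \<noteq> 0" using F(1)[OF t] by auto
    have "sgn (z t) = sgn (z t0)"
    proof (rule inward_passage_radial[OF sm \<rho>(2) _ s t(1) near _ _ L0])
      show "\<bar>z t0 \<bullet> z t0 / 2 - V (sqrt (w t0 \<bullet> w t0 + 0\<^sup>2))\<bar> \<le> H"
        using energy[of t0] t0 by (simp add: H_def)
      fix s assume "s \<in> {t0..t}"
      then show "w s \<bullet> z s \<le> 0" using inward[of s] t by auto
    qed (use t0 in auto)
    moreover have "(w t \<bullet> w t) * (z t \<bullet> z t) = (w t \<bullet> z t)\<^sup>2"
      using central_motion_angular_momentum[OF s t(1)] L0 by simp
    \<comment> \<open>Equality in Cauchy-Schwarz, with the sign fixed by the inward motion: the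
      position is a negative multiple of the velocity.\<close>
    then have "(- (w t \<bullet> z t))\<^sup>2 = (norm (w t) * norm (z t))\<^sup>2"
      by (simp add: power_mult_distrib power2_norm_eq_inner)
    then have "- (w t \<bullet> z t) = norm (w t) * norm (z t)"
      by (rule power2_eq_imp_eq) (use inward[OF t] in auto)
    then have "(- w t) \<bullet> z t = norm (- w t) * norm (z t)" by simp
    then have "norm (- w t) *\<^sub>R z t = norm (z t) *\<^sub>R (- w t)"
      unfolding norm_cauchy_schwarz_eq .
    then have "inverse (norm (z t)) *\<^sub>R (norm (w t) *\<^sub>R z t) = inverse (norm (z t)) *\<^sub>R (norm (z t) *\<^sub>R (- w t))"
      by simp
    then have "w t = - norm (w t) *\<^sub>R sgn (z t)"
      using z0 by (simp add: sgn_div_norm mult.commute)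
    ultimately show "z t \<noteq> 0 \<and> sgn (z t) = sgn (z t0) \<and> w t = - norm (w t) *\<^sub>R sgn (z t0) \<and> w t \<bullet> z t < 0"
      using z0 inward[OF t] by simp
  qed
qed

text \<open>At a fixed time a close to T the orbit w has small radius, bounded energy, inward motion
  and direction e. These are open conditions on the state and on \<epsilon>, hence shared by all
  motions that start close by, and from a on the passage estimates control such motions. If the
  motion goes inward all the way to \<open>c\<close>, then \<open>p\<close> is \<open>c\<close>
  itself.\<close>

lemma collision_approach:
  fixes w z :: "real \<Rightarrow> 'a::real_inner"
  assumes V: "V \<in> class_V_star" and S: "admissible_bound V S"
    and wz: "central_motion V 0 {0..<T} w z" and T: "0 < T" and lim: "(w \<longlongrightarrow> 0) (at_left T)"
    and t0: "0 \<le> t0" "t0 < T" and e: "norm e = 1"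
    and radial: "\<And>t. t0 \<le> t \<Longrightarrow> t < T \<Longrightarrow> z t \<noteq> 0 \<and> sgn (z t) = e \<and> w t = - norm (w t) *\<^sub>R e \<and> w t \<bullet> z t < 0"
    and \<kappa>: "0 < \<kappa>"
  obtains a d where "0 \<le> a" "T - \<kappa> < a" "a < T" "0 < d"
    "\<And>\<epsilon> u v c t. 0 \<le> \<epsilon> \<Longrightarrow> \<epsilon> < d \<Longrightarrow> central_motion V \<epsilon> {0..c} u v \<Longrightarrow>
       dist (u 0) (w 0) < d \<Longrightarrow> dist (v 0) (z 0) < d \<Longrightarrow> 0 \<le> t \<Longrightarrow> t \<le> c \<Longrightarrow> t \<le> a \<Longrightarrow>
       dist (u t) (w t) < \<kappa> \<and> dist (v t) (z t) < \<kappa>"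
    "\<And>\<epsilon> u v c. 0 \<le> \<epsilon> \<Longrightarrow> \<epsilon> < d \<Longrightarrow> central_motion V \<epsilon> {0..c} u v \<Longrightarrow>
       dist (u 0) (w 0) < d \<Longrightarrow> dist (v 0) (z 0) < d \<Longrightarrow> a \<le> c \<Longrightarrow>
       \<exists>p\<in>{a..c}. p < T + \<kappa> \<and> (\<forall>t\<in>{a..p}. norm (u t) \<le> \<kappa>) \<and>
         (p = c \<or> u p \<bullet> v p = 0 \<and> v p \<noteq> 0 \<and> norm (sgn (v p) - e) < \<kappa>)"
proof -
  have sm: "smooth_pos V" using V by (auto simp: class_V_star_def class_V_def)
  define h where "h = z 0 \<bullet> z 0 / 2 - V (sqrt (w 0 \<bullet> w 0 + 0\<^sup>2))"
  \<comment> \<open>The extra 1 leaves room for the energies of nearby motions.\<close>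
  define H where "H = \<bar>h\<bar> + 1"
  \<comment> \<open>The turning 2 pi \<eta> is to be at most \<kappa> / 2; the other half is spent
    on the direction at time a.\<close>
  define \<eta> where "\<eta> = min (1 / 2) (\<kappa> / (4 * pi))"
  have \<eta>: "0 < \<eta>" "\<eta> \<le> 1 / 2" "\<eta> \<le> \<kappa> / (4 * pi)" using \<kappa> by (auto simp: \<eta>_def)
  have \<eta>\<kappa>: "2 * pi * \<eta> \<le> \<kappa> / 2" using mult_left_mono[OF \<eta>(3), of "2 * pi"] by simp
  from force_small_exists[OF V S \<eta>(1), of H]
  obtain \<rho> where \<rho>: "0 < \<rho>" "force_small V H \<eta> \<rho>" by blast
  have lim2: "((\<lambda>t. w t \<bullet> w t) \<longlongrightarrow> 0) (at_left T)"
    using tendsto_inner[OF lim lim] by simp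
  have "\<forall>\<^sub>F t in at_left T. w t \<bullet> w t < \<rho>" using order_tendstoD(2)[OF lim2 \<rho>(1)] .
  \<comment> \<open>The passage lasts at most 2 |u a| < \<kappa>, whence p < T + \<kappa>.\<close>
  moreover have "\<forall>\<^sub>F t in at_left T. norm (w t) < \<kappa> / 2"
    using order_tendstoD(2)[OF tendsto_norm[OF lim], of "\<kappa> / 2"] \<kappa> by simp
  moreover have "\<forall>\<^sub>F t in at_left T. t0 < t" "\<forall>\<^sub>F t in at_left T. t < T" "\<forall>\<^sub>F t in at_left T. T - \<kappa> < t"
    using t0 \<kappa> by (auto simp: eventually_at_left_field intro: exI[of _ "T - \<kappa>"])
  ultimately have "\<forall>\<^sub>F t in at_left T. w t \<bullet> w t < \<rho> \<and> norm (w t) < \<kappa> / 2 \<and> t0 < t \<and> t < T \<and> T - \<kappa> < t"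
    by eventually_elim auto
  then obtain a where a: "w a \<bullet> w a < \<rho>" "norm (w a) < \<kappa> / 2" "t0 < a" "a < T" "T - \<kappa> < a"
    using eventually_happens[of _ "at_left T"] by (auto simp: trivial_limit_at_left_real)
  have a0: "0 \<le> a" using a t0 by simp
  have ra: "z a \<noteq> 0" "sgn (z a) = e" "w a \<bullet> z a < 0" using radial[of a] a by auto
  have wa: "0 < w a \<bullet> w a" using central_motionD(1)[OF wz, of a] a a0 by simp
  have wza: "central_motion V 0 {0..a} w z" using a by (intro central_motion_subset[OF wz]) auto
  have ha: "z a \<bullet> z a / 2 - V (sqrt (w a \<bullet> w a)) = h"
    using central_motion_energy[OF sm wza a0] by (simp add: h_def)
  \<comment> \<open>State and \<epsilon> are packed into one variable, so that the open conditions
    hold together on one neighbourhood.\<close>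
  let ?N = "nhds (w a, z a, 0::real)"
  define x y \<epsilon> where "x = (\<lambda>q::'a \<times> 'a \<times> real. fst q)" and "y = (\<lambda>q::'a \<times> 'a \<times> real. fst (snd q))"
    and "\<epsilon> = (\<lambda>q::'a \<times> 'a \<times> real. snd (snd q))"
  have lx: "(x \<longlongrightarrow> w a) ?N" unfolding x_def using tendsto_fst[OF filterlim_ident] by force
  have ly: "(y \<longlongrightarrow> z a) ?N" unfolding y_def using tendsto_fst[OF tendsto_snd[OF filterlim_ident]] by force
  have l\<epsilon>: "(\<epsilon> \<longlongrightarrow> 0) ?N" unfolding \<epsilon>_def using tendsto_snd[OF tendsto_snd[OF filterlim_ident]] by force
  have l\<sigma>: "((\<lambda>q. x q \<bullet> x q + (\<epsilon> q)\<^sup>2) \<longlongrightarrow> w a \<bullet> w a + 0\<^sup>2) ?N"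
    by (intro tendsto_intros lx l\<epsilon>)
  have "isCont V (sqrt (w a \<bullet> w a + 0\<^sup>2))"
    using wa by (intro DERIV_isCont[OF smooth_pos_deriv(1)[OF sm]]) simp
  from isCont_tendsto_compose[OF this tendsto_real_sqrt[OF l\<sigma>]]
  have "((\<lambda>q. \<bar>y q \<bullet> y q / 2 - V (sqrt (x q \<bullet> x q + (\<epsilon> q)\<^sup>2))\<bar>) \<longlongrightarrow> \<bar>z a \<bullet> z a / 2 - V (sqrt (w a \<bullet> w a + 0\<^sup>2))\<bar>) ?N"
    by (intro tendsto_intros ly) auto
  then have "((\<lambda>q. \<bar>y q \<bullet> y q / 2 - V (sqrt (x q \<bullet> x q + (\<epsilon> q)\<^sup>2))\<bar>) \<longlongrightarrow> \<bar>h\<bar>) ?N"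
    using ha by simp
  from order_tendstoD(2)[OF this, of H]
  have "\<forall>\<^sub>F q in ?N. \<bar>y q \<bullet> y q / 2 - V (sqrt (x q \<bullet> x q + (\<epsilon> q)\<^sup>2))\<bar> < H" by (simp add: H_def)
  moreover have "\<forall>\<^sub>F q in ?N. x q \<bullet> x q + (\<epsilon> q)\<^sup>2 < \<rho>"
    using order_tendstoD(2)[OF l\<sigma>, of \<rho>] a by simp
  moreover have "\<forall>\<^sub>F q in ?N. norm (x q) < \<kappa> / 2"
    using order_tendstoD(2)[OF tendsto_norm[OF lx] a(2)] .
  moreover have "\<forall>\<^sub>F q in ?N. x q \<bullet> y q < 0"
    using order_tendstoD(2)[OF tendsto_inner[OF lx ly]] ra by simp
  moreover have "\<forall>\<^sub>F q in ?N. dist (sgn (y q)) e < \<kappa> / 2"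
    using tendstoD[OF tendsto_sgn[OF ly ra(1)], of "\<kappa> / 2"] ra \<kappa> by simp
  ultimately have "\<forall>\<^sub>F q in ?N. \<bar>y q \<bullet> y q / 2 - V (sqrt (x q \<bullet> x q + (\<epsilon> q)\<^sup>2))\<bar> < H \<and>
      x q \<bullet> x q + (\<epsilon> q)\<^sup>2 < \<rho> \<and> norm (x q) < \<kappa> / 2 \<and> x q \<bullet> y q < 0 \<and> dist (sgn (y q)) e < \<kappa> / 2"
    by eventually_elim auto
  then obtain d1 where d1: "0 < d1" "\<And>q. dist q (w a, z a, 0) < d1 \<Longrightarrow>
      \<bar>y q \<bullet> y q / 2 - V (sqrt (x q \<bullet> x q + (\<epsilon> q)\<^sup>2))\<bar> < H \<and>
      x q \<bullet> x q + (\<epsilon> q)\<^sup>2 < \<rho> \<and> norm (x q) < \<kappa> / 2 \<and> x q \<bullet> y q < 0 \<and> dist (sgn (y q)) e < \<kappa> / 2"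
    unfolding eventually_nhds_metric by blast
  have near: "\<bar>Y \<bullet> Y / 2 - V (sqrt (X \<bullet> X + E\<^sup>2))\<bar> < H \<and>
      X \<bullet> X + E\<^sup>2 < \<rho> \<and> norm X < \<kappa> / 2 \<and> X \<bullet> Y < 0 \<and> dist (sgn Y) e < \<kappa> / 2"
    if "dist X (w a) < d1 / 3" "dist Y (z a) < d1 / 3" "0 \<le> E" "E < d1 / 3" for X Y E
  proof -
    have "dist (X, Y, E) (w a, z a, 0) \<le> dist X (w a) + dist (Y, E) (z a, 0)"
      unfolding dist_Pair_Pair[of X] by (intro sqrt_sum_squares_le_sum) auto
    also have "dist (Y, E) (z a, 0) \<le> dist Y (z a) + dist E 0"
      unfolding dist_Pair_Pair by (intro sqrt_sum_squares_le_sum) auto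
    finally have "dist (X, Y, E) (w a, z a, 0) < d1" using that by (simp add: dist_real_def)
    from d1(2)[OF this] show ?thesis by (simp add: x_def y_def \<epsilon>_def)
  qed
  have "0 < min \<kappa> (d1 / 3)" using \<kappa> d1 by simp
  obtain d2 where d2: "0 < d2" and "d2 \<le> 1" and d2': "\<And>\<epsilon> u v c t. 0 \<le> \<epsilon> \<Longrightarrow> \<epsilon> < d2 \<Longrightarrow> c \<le> a \<Longrightarrow> central_motion V \<epsilon> {0..c} u v \<Longrightarrow>
       dist (u 0) (w 0) < d2 \<Longrightarrow> dist (v 0) (z 0) < d2 \<Longrightarrow> t \<in> {0..c} \<Longrightarrow>
       dist (u t) (w t) < min \<kappa> (d1 / 3) \<and> dist (v t) (z t) < min \<kappa> (d1 / 3)"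
    by (rule central_motion_continuous_dependence[OF sm wza \<open>0 < min \<kappa> (d1 / 3)\<close>]) (rule that; assumption)
  show ?thesis
  proof (rule that[OF a0 a(5) a(4), of "min d2 (d1 / 3)"])
    show "0 < min d2 (d1 / 3)" using d1 d2 by simp
    fix \<epsilon> c and u v :: "real \<Rightarrow> 'a"
    assume eps: "0 \<le> \<epsilon>" "\<epsilon> < min d2 (d1 / 3)" and uv: "central_motion V \<epsilon> {0..c} u v"
      and init: "dist (u 0) (w 0) < min d2 (d1 / 3)" "dist (v 0) (z 0) < min d2 (d1 / 3)"
    have close: "dist (u t) (w t) < min \<kappa> (d1 / 3) \<and> dist (v t) (z t) < min \<kappa> (d1 / 3)"
      if "0 \<le> t" "t \<le> c" "t \<le> a" for t
    proof (rule d2'[of \<epsilon> t])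
      show "central_motion V \<epsilon> {0..t} u v" using that by (intro central_motion_subset[OF uv]) auto
    qed (use eps init that in auto)
    then show "dist (u t) (w t) < \<kappa> \<and> dist (v t) (z t) < \<kappa>" if "0 \<le> t" "t \<le> c" "t \<le> a" for t
      using that by simp
    assume ac: "a \<le> c"
    have "\<bar>v a \<bullet> v a / 2 - V (sqrt (u a \<bullet> u a + \<epsilon>\<^sup>2))\<bar> < H \<and>
      u a \<bullet> u a + \<epsilon>\<^sup>2 < \<rho> \<and> norm (u a) < \<kappa> / 2 \<and> u a \<bullet> v a < 0 \<and> dist (sgn (v a)) e < \<kappa> / 2"
      using close[OF a0 ac] eps by (intro near) auto
    then have na: "\<bar>v a \<bullet> v a / 2 - V (sqrt (u a \<bullet> u a + \<epsilon>\<^sup>2))\<bar> \<le> H" "u a \<bullet> u a + \<epsilon>\<^sup>2 \<le> \<rho>"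
      "norm (u a) < \<kappa> / 2" "u a \<bullet> v a \<le> 0" "norm (sgn (v a) - e) < \<kappa> / 2" by (auto simp: dist_norm)
    have pass: "p < T + \<kappa> \<and> (\<forall>t\<in>{a..p}. norm (u t) \<le> \<kappa>) \<and> v p \<noteq> 0 \<and> norm (sgn (v p) - e) < \<kappa>"
      if p: "a \<le> p" "p \<le> c" and inw: "\<And>t. t \<in> {a..p} \<Longrightarrow> u t \<bullet> v t \<le> 0" for p
    proof -
      have m: "central_motion V \<epsilon> {a..t} u v" if "t \<le> p" for t
        using that p a0 by (intro central_motion_subset[OF uv]) auto
      have "norm (u t) \<le> \<kappa>" if t: "t \<in> {a..p}" for t
      proof -
        have "u t \<bullet> u t \<le> u a \<bullet> u a"
          by (rule inward_passage_radius[OF sm \<rho>(2) \<eta>(2) m _ na(2,1)]) (use t inw in auto)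
        then have "norm (u t) \<le> norm (u a)" by (simp add: norm_eq_sqrt_inner)
        then show ?thesis using na(3) \<kappa> by simp
      qed
      moreover have "p - a \<le> 2 * norm (u a)"
        by (rule inward_passage_time[OF sm \<rho>(2) \<eta>(2) m p(1) na(2,1)]) (use inw in auto)
      moreover have "1 \<le> v p \<bullet> v p"
        by (rule inward_passage_force(1)[OF sm \<rho>(2) \<eta>(2) m p(1) na(2,1)]) (use inw in auto)
      moreover have "norm (sgn (v p) - sgn (v a)) \<le> 2 * pi * \<eta>"
        by (rule inward_passage_deflection_bound[OF sm \<rho>(2) \<eta>(2) m p(1) na(2,1)]) (use inw \<eta> in auto)
      moreover have "norm (sgn (v p) - e) \<le> norm (sgn (v p) - sgn (v a)) + norm (sgn (v a) - e)"
        by (metis norm_diff_triangle_ineq diff_add_cancel norm_triangle_ineq add_diff_eq)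
      ultimately show ?thesis using na(3,5) a(4) \<eta>\<kappa> by auto
    qed
    show "\<exists>p\<in>{a..c}. p < T + \<kappa> \<and> (\<forall>t\<in>{a..p}. norm (u t) \<le> \<kappa>) \<and>
         (p = c \<or> u p \<bullet> v p = 0 \<and> v p \<noteq> 0 \<and> norm (sgn (v p) - e) < \<kappa>)"
    proof (cases "\<forall>t\<in>{a..c}. u t \<bullet> v t \<le> 0")
      case True
      then show ?thesis using pass[of c] ac by (intro bexI[of _ c]) auto
    next
      case False
      then obtain t where t: "t \<in> {a..c}" "0 < u t \<bullet> v t" by force
      have "central_motion V \<epsilon> {a..c} u v" using a0 by (intro central_motion_subset[OF uv]) auto
      from pericenter_exists[OF this na(4) t]
      obtain p where p: "p \<in> {a..c}" "u p \<bullet> v p = 0" "\<And>s. s \<in> {a..p} \<Longrightarrow> u s \<bullet> v s \<le> 0" by blast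
      then show ?thesis using pass[of p] by (intro bexI[of _ p]) auto
    qed
  qed
qed

definition transmission_path :: "real \<Rightarrow> (real \<Rightarrow> 'a::real_vector) \<Rightarrow> real \<Rightarrow> 'a" where
  "transmission_path T w t = (if t < T then w t else if t = T then 0 else - w (2 * T - t))"

text \<open>Up to a the paths are close by continuous dependence; from a to T + \<tau> both are near
  the centre. The state at T + \<tau> is the reflection of the state at 2p - (T + \<tau>), a time
  close to T - \<tau>, in a mirror whose normal is close to e. Hence it is close to the state of t
  -> -w(2T - t), and continuous dependence along this classical orbit covers the rest.\<close>

lemma collision_transmission:
  fixes w z :: "real \<Rightarrow> 'a::real_inner"
  assumes V: "V \<in> class_V_star" and S: "admissible_bound V S"
    and wz: "central_motion V 0 {0..<T} w z" and T: "0 < T" and lim: "(w \<longlongrightarrow> 0) (at_left T)"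
    and r: "0 < r"
  obtains d where "0 < d"
    "\<And>\<epsilon> u v c t. 0 \<le> \<epsilon> \<Longrightarrow> \<epsilon> < d \<Longrightarrow> c \<le> 2 * T \<Longrightarrow> central_motion V \<epsilon> {0..c} u v \<Longrightarrow>
       dist (u 0) (w 0) < d \<Longrightarrow> dist (v 0) (z 0) < d \<Longrightarrow> t \<in> {0..c} \<Longrightarrow>
       dist (u t) (transmission_path T w t) < r"
proof -
  have sm: "smooth_pos V" using V by (auto simp: class_V_star_def class_V_def)
  obtain t0 e where t0: "0 \<le> t0" "t0 < T" and e: "norm e = 1"
    and radial: "\<And>t. t0 \<le> t \<Longrightarrow> t < T \<Longrightarrow> z t \<noteq> 0 \<and> sgn (z t) = e \<and> w t = - norm (w t) *\<^sub>R e \<and> w t \<bullet> z t < 0"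
    by (rule collision_orbit_radial[OF V S wz T lim]) (rule that; assumption)
  have "\<forall>\<^sub>F t in at_left T. norm (w t) < r / 4"
    using order_tendstoD(2)[OF tendsto_norm[OF lim], of "r / 4"] r by simp
  then obtain b1 where b1: "b1 < T" "\<And>t. b1 < t \<Longrightarrow> t < T \<Longrightarrow> norm (w t) < r / 4"
    by (auto simp: eventually_at_left_field)
  define b where "b = (max b1 t0 + T) / 2"
  have b: "b < T" "t0 < b" "b1 < b" using b1 t0 by (auto simp: b_def)
  have wb: "norm (w t) < r / 4" if "b \<le> t" "t < T" for t using b1(2)[of t] b that by simp
  \<comment> \<open>The mirror time of t \<le> T + \<tau> is at least T - \<tau> - 2 \<kappa>, hence
    at least b since \<kappa> \<le> \<tau> / 4; on [b, T) the orbit w stays within r / 4 of the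
    centre.\<close>
  define \<tau> where "\<tau> = (T - b) / 2"
  have \<tau>: "0 < \<tau>" "T - 2 * \<tau> = b" using b by (auto simp: \<tau>_def field_simps)
  define x0 y0 where "x0 = w (T - \<tau>)" and "y0 = z (T - \<tau>)"
  \<comment> \<open>On this interval 2T - t stays in [0, T - \<tau>], away from the
    collision.\<close>
  have mirror: "central_motion V 0 {T + \<tau>..2 * T} (\<lambda>t. - w (2 * T - t)) (\<lambda>t. - (- z (2 * T - t)))"
    by (rule central_motion_reflect[OF wz, of uminus])
      (use \<tau> in \<open>auto intro: bounded_linear_minus bounded_linear_ident\<close>)
  obtain d3 where d3: "0 < d3" and "d3 \<le> 1" and d3': "\<And>\<epsilon> u v c t. 0 \<le> \<epsilon> \<Longrightarrow> \<epsilon> < d3 \<Longrightarrow> c \<le> 2 * T \<Longrightarrow>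
       central_motion V \<epsilon> {T + \<tau>..c} u v \<Longrightarrow>
       dist (u (T + \<tau>)) (- w (2 * T - (T + \<tau>))) < d3 \<Longrightarrow>
       dist (v (T + \<tau>)) (- (- z (2 * T - (T + \<tau>)))) < d3 \<Longrightarrow> t \<in> {T + \<tau>..c} \<Longrightarrow>
       dist (u t) (- w (2 * T - t)) < r \<and> dist (v t) (- (- z (2 * T - t))) < r"
    by (rule central_motion_continuous_dependence[OF sm mirror r]) (rule that; assumption)
  define R where "R x E = x - (2 * (x \<bullet> E)) *\<^sub>R E" for x E :: 'a
  have rad: "x0 = - norm x0 *\<^sub>R e" "y0 = norm y0 *\<^sub>R e"
  proof -
    have "z (T - \<tau>) \<noteq> 0 \<and> sgn (z (T - \<tau>)) = e \<and> w (T - \<tau>) = - norm (w (T - \<tau>)) *\<^sub>R e"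
      using radial[of "T - \<tau>"] \<tau> b by auto
    then show "x0 = - norm x0 *\<^sub>R e" "y0 = norm y0 *\<^sub>R e"
      by (auto simp: x0_def y0_def sgn_div_norm)
  qed
  have ee: "e \<bullet> e = 1" using e by (simp add: dot_square_norm)
  \<comment> \<open>The state at T - \<tau> lies on the line of e, where the limit reflection acts
    as -1: the position becomes -x0, and the velocity, reversed once more, stays y0.\<close>
  have Re: "R (k *\<^sub>R e) e = - (k *\<^sub>R e)" for k
    by (simp add: R_def ee flip: scaleR_left_diff_distrib scaleR_minus_left)
  have l1: "(fst \<longlongrightarrow> x) (nhds (x, e))" and l2: "(snd \<longlongrightarrow> e) (nhds (x, e))" for x
    using tendsto_fst[OF filterlim_ident] tendsto_snd[OF filterlim_ident] by force+
  have lR: "((\<lambda>q. R (fst q) (snd q)) \<longlongrightarrow> R x e) (nhds (x, e))" for x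
    unfolding R_def by (intro tendsto_intros l1 l2)
  have cR: "\<exists>d>0. \<forall>X E. dist X x < d \<longrightarrow> dist E e < d \<longrightarrow> dist (R X E) (R x e) < d3" for x
  proof -
    obtain d where d: "0 < d" "\<And>q. dist q (x, e) < d \<Longrightarrow> dist (R (fst q) (snd q)) (R x e) < d3"
      using tendstoD[OF lR d3, of x] unfolding eventually_nhds_metric by blast
    have "dist (R X E) (R x e) < d3" if "dist X x < d / 2" "dist E e < d / 2" for X E
    proof -
      have "dist (X, E) (x, e) \<le> dist X x + dist E e"
        unfolding dist_Pair_Pair by (intro sqrt_sum_squares_le_sum) auto
      then show ?thesis using d(2)[of "(X, E)"] that by simp
    qed
    then show ?thesis using d(1) by (intro exI[of _ "d / 2"]) auto
  qed
  obtain dx where dx: "0 < dx" "\<And>X E. dist X x0 < dx \<Longrightarrow> dist E e < dx \<Longrightarrow> dist (R X E) (R x0 e) < d3"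
    using cR[of x0] by blast
  obtain dy where dy: "0 < dy" "\<And>X E. dist X y0 < dy \<Longrightarrow> dist E e < dy \<Longrightarrow> dist (R X E) (R y0 e) < d3"
    using cR[of y0] by blast
  define m where "m = min dx dy"
  have m: "0 < m" "m \<le> dx" "m \<le> dy" using dx dy by (auto simp: m_def)
  have bT: "T - \<tau> \<in> {0..<T}" using \<tau> b t0 by auto
  obtain \<delta>1 where \<delta>1: "0 < \<delta>1" "\<And>s. s \<in> {0..<T} \<Longrightarrow> dist s (T - \<tau>) < \<delta>1 \<Longrightarrow> dist (w s) x0 < m / 2"
    using central_motion_continuous(1)[OF wz] bT m(1) unfolding continuous_on_iff x0_def by (meson half_gt_zero)
  obtain \<delta>2 where \<delta>2: "0 < \<delta>2" "\<And>s. s \<in> {0..<T} \<Longrightarrow> dist s (T - \<tau>) < \<delta>2 \<Longrightarrow> dist (z s) y0 < m / 2"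
    using central_motion_continuous(2)[OF wz] bT m(1) unfolding continuous_on_iff y0_def by (meson half_gt_zero)
  \<comment> \<open>m / 2 leaves m / 2 for the variation of w and z and keeps the mirror normal
    within m of e. Since |p - T| < \<kappa>, the time 2p - (T + \<tau>) is within 2 \<kappa> of T -
    \<tau>, which accounts for \<delta>1 / 4 and \<delta>2 / 4.\<close>
  define \<kappa> where "\<kappa> = Min {m / 2, \<delta>1 / 4, \<delta>2 / 4, r / 4, \<tau> / 4}"
  have \<kappa>: "0 < \<kappa>" "\<kappa> \<le> m / 2" "\<kappa> \<le> \<delta>1 / 4" "\<kappa> \<le> \<delta>2 / 4" "\<kappa> \<le> r / 4" "\<kappa> \<le> \<tau> / 4"
    using m(1) \<delta>1(1) \<delta>2(1) r \<tau>(1) by (auto simp: \<kappa>_def)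
  obtain a d where a: "0 \<le> a" "T - \<kappa> < a" "a < T" and d: "0 < d" and before:
    "\<And>\<epsilon> u v c t. 0 \<le> \<epsilon> \<Longrightarrow> \<epsilon> < d \<Longrightarrow> central_motion V \<epsilon> {0..c} u v \<Longrightarrow>
       dist (u 0) (w 0) < d \<Longrightarrow> dist (v 0) (z 0) < d \<Longrightarrow> 0 \<le> t \<Longrightarrow> t \<le> c \<Longrightarrow> t \<le> a \<Longrightarrow>
       dist (u t) (w t) < \<kappa> \<and> dist (v t) (z t) < \<kappa>"
   and turn:
    "\<And>\<epsilon> u v c. 0 \<le> \<epsilon> \<Longrightarrow> \<epsilon> < d \<Longrightarrow> central_motion V \<epsilon> {0..c} u v \<Longrightarrow>
       dist (u 0) (w 0) < d \<Longrightarrow> dist (v 0) (z 0) < d \<Longrightarrow> a \<le> c \<Longrightarrow>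
       \<exists>p\<in>{a..c}. p < T + \<kappa> \<and> (\<forall>t\<in>{a..p}. norm (u t) \<le> \<kappa>) \<and>
         (p = c \<or> u p \<bullet> v p = 0 \<and> v p \<noteq> 0 \<and> norm (sgn (v p) - e) < \<kappa>)"
    by (rule collision_approach[OF V S wz T lim t0 e radial \<kappa>(1)]) (assumption | rule that; assumption)+
  show ?thesis
  proof (rule that[of "min d d3"])
    show "0 < min d d3" using d d3 by simp
    fix \<epsilon> c t and u v :: "real \<Rightarrow> 'a"
    assume eps: "0 \<le> \<epsilon>" "\<epsilon> < min d d3" and c: "c \<le> 2 * T" and uv: "central_motion V \<epsilon> {0..c} u v"
      and init: "dist (u 0) (w 0) < min d d3" "dist (v 0) (z 0) < min d d3" and t: "t \<in> {0..c}"
    have close: "dist (u s) (w s) < \<kappa> \<and> dist (v s) (z s) < \<kappa>" if "0 \<le> s" "s \<le> c" "s \<le> a" for s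
      by (rule before[OF _ _ uv]) (use eps init that in auto)
    show "dist (u t) (transmission_path T w t) < r"
    proof (cases "t \<le> a")
      case True
      then show ?thesis using close[of t] t a \<kappa> r by (auto simp: transmission_path_def)
    next
      case False
      then have ac: "a \<le> c" "a \<le> t" using t by auto
      have "\<exists>p\<in>{a..c}. p < T + \<kappa> \<and> (\<forall>t\<in>{a..p}. norm (u t) \<le> \<kappa>) \<and>
         (p = c \<or> u p \<bullet> v p = 0 \<and> v p \<noteq> 0 \<and> norm (sgn (v p) - e) < \<kappa>)"
        by (rule turn[OF _ _ uv]) (use eps init ac in auto)
      then obtain p where p: "a \<le> p" "p \<le> c" "p < T + \<kappa>" "\<And>t. t \<in> {a..p} \<Longrightarrow> norm (u t) \<le> \<kappa>"
         "p \<noteq> c \<Longrightarrow> u p \<bullet> v p = 0 \<and> v p \<noteq> 0 \<and> norm (sgn (v p) - e) < \<kappa>" by auto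
      have mirrored: "u s = R (u (2 * p - s)) (sgn (v p))" "v s = - R (v (2 * p - s)) (sgn (v p))"
        if "p < s" "s \<le> c" "0 \<le> 2 * p - s" for s
        unfolding R_def by (rule pericenter_reflection[OF sm uv]; use p a that in auto)+
      have nR: "norm (R x (sgn E)) = norm x" for x E
        unfolding R_def norm_eq_sqrt_inner reflection_isometry(2) ..
      show ?thesis
      proof (cases "t \<le> T + \<tau>")
        case True
        \<comment> \<open>In this time zone smallness of both paths replaces closeness: r / 2 for u
          and r / 4 for the transmission path.\<close>
        have "norm (u t) \<le> r / 2"
        proof (cases "t \<le> p")
          case True
          then show ?thesis using p(4)[of t] ac \<kappa> r by auto
        next
          case False
          have s: "b \<le> 2 * p - t" "0 \<le> 2 * p - t" using True p(1) a \<kappa> \<tau> b t0 by auto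
          have eq: "norm (u t) = norm (u (2 * p - t))"
            using mirrored(1)[of t] nR False t s by simp
          show ?thesis
          proof (cases "a \<le> 2 * p - t")
            case True
            then show ?thesis using p(4)[of "2 * p - t"] False eq \<kappa> r by auto
          next
            case 2: False
            have "dist (u (2 * p - t)) (w (2 * p - t)) < \<kappa>"
              using close[of "2 * p - t"] s 2 ac by auto
            moreover have "norm (w (2 * p - t)) < r / 4" using wb[of "2 * p - t"] s 2 a by simp
            ultimately show ?thesis
              unfolding eq dist_norm using \<kappa>(5) norm_triangle_sub[of "u (2 * p - t)" "w (2 * p - t)"] by linarith
          qed
        qed
        moreover have "norm (transmission_path T w t) < r / 4"
        proof -
          have "b \<le> t" using ac a \<kappa> \<tau> by linarith
          moreover have "b \<le> 2 * T - t" using True \<tau> by linarith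
          ultimately show ?thesis
            using wb[of t] wb[of "2 * T - t"] r by (auto simp: transmission_path_def)
        qed
        ultimately show ?thesis
          using norm_triangle_ineq4[of "u t" "transmission_path T w t"] r unfolding dist_norm by linarith
      next
        case False
        define s where "s = 2 * p - (T + \<tau>)"
        have sc: "T + \<tau> \<le> c" "p < T + \<tau>" using False t p \<kappa> by auto
        have sa: "0 \<le> s" "s \<le> a" "s < T" using p(1,3) a \<kappa> \<tau> b t0 by (auto simp: s_def)
        have ds: "dist s (T - \<tau>) < \<delta>1" "dist s (T - \<tau>) < \<delta>2"
          using p(1,3) a \<kappa> unfolding s_def dist_real_def by linarith+
        have ws: "dist (w s) x0 < m / 2" "dist (z s) y0 < m / 2"
          using \<delta>1(2)[of s] \<delta>2(2)[of s] ds sa by auto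
        have us: "dist (u s) (w s) < \<kappa>" "dist (v s) (z s) < \<kappa>"
          using close[of s] sa ac by auto
        have xs: "dist (u s) x0 < m" "dist (v s) y0 < m"
          using dist_triangle[of "u s" x0 "w s"] dist_triangle[of "v s" y0 "z s"] ws us \<kappa> by linarith+
        have sg: "dist (sgn (v p)) e < m" using p(5) sc \<kappa> m(1) by (auto simp: dist_norm)
        have "dist (u (T + \<tau>)) (R x0 e) < d3"
          using dx(2)[of "u s" "sgn (v p)"] mirrored(1)[of "T + \<tau>"] xs sg m sc sa by (simp add: s_def)
        moreover have "R x0 e = - x0" using Re[of "- norm x0"] rad(1) by metis
        moreover have "dist (- R (v s) (sgn (v p))) (- R y0 e) < d3"
          using dy(2)[of "v s" "sgn (v p)"] xs sg m by (simp add: dist_minus)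
        then have "dist (v (T + \<tau>)) (- R y0 e) < d3"
          using mirrored(2)[of "T + \<tau>"] sc sa by (simp add: s_def)
        moreover have "- R y0 e = y0" using Re[of "norm y0"] rad(2) by (metis minus_minus)
        moreover have "central_motion V \<epsilon> {T + \<tau>..c} u v"
          using T \<tau> by (intro central_motion_subset[OF uv]) auto
        ultimately have "dist (u t) (- w (2 * T - t)) < r"
          using d3'[of \<epsilon> c u v t] eps c False t by (simp add: x0_def y0_def)
        then show ?thesis using False \<tau> by (simp add: transmission_path_def)
      qed
    qed
  qed
qed

section \<open>Existence of the smoothed motions\<close>

text \<open>Picard iteration contracts on the whole interval at once when it is carried out on
  \<open>e\<^sup>-\<^sup>k\<^sup>t y(t)\<close> with \<open>k > 2L\<close>.\<close>

lemma lipschitz_ode_exists: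
  fixes f :: "'a::banach \<Rightarrow> 'a"
  assumes L: "0 \<le> L" "\<And>x y. norm (f x - f y) \<le> L * norm (x - y)" and b: "0 \<le> b"
  obtains y where "y 0 = y0" "\<And>t. t \<in> {0..b} \<Longrightarrow> (y has_vector_derivative f (y t)) (at t within {0..b})"
proof -
  define k where "k = 2 * L + 1"
  have k: "0 < k" "2 * L \<le> k" using L by (auto simp: k_def)
  \<comment> \<open>Clamping to [0, b] extends the iterates to bounded continuous functions on the
    whole line, which form a complete space.\<close>
  define c where "c t = max 0 (min b t)" for t :: real
  have c: "c t \<in> {0..b}" "continuous_on UNIV c" for t
    using b by (auto simp: c_def intro!: continuous_intros)
  have cont_f: "continuous_on UNIV f"
  proof (rule continuous_on_subset[OF lipschitz_on_continuous_on])
    show "L-lipschitz_on UNIV f" using L by (intro lipschitz_onI) (auto simp: dist_norm)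
  qed simp
  define g where "g x s = f (exp (k * s) *\<^sub>R apply_bcontfun x s)" for x :: "real \<Rightarrow>\<^sub>C 'a" and s
  have cont_g: "continuous_on A (g x)" for A x
    unfolding g_def[abs_def] by (rule continuous_on_compose2[OF cont_f]) (auto intro!: continuous_intros)
  have int_g: "g x integrable_on {0..t}" for x t
    by (rule integrable_continuous_real[OF cont_g])
  \<comment> \<open>The integral equation for y, rewritten for exp(-k t) y(t).\<close>
  define F where "F x t = exp (- k * t) *\<^sub>R (y0 + integral {0..t} (g x))" for x t
  have cont_F: "continuous_on {0..b} (F x)" for x
    unfolding F_def[abs_def] by (intro continuous_intros indefinite_integral_continuous_1 int_g)
  define P where "P x = Bcontfun (\<lambda>t. F x (c t))" for x
  have P: "apply_bcontfun (P x) t = F x (c t)" for x t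
  proof -
    have "continuous_on UNIV (\<lambda>t. F x (c t))"
      by (rule continuous_on_compose2[OF cont_F c(2)]) (use c in auto)
    moreover have "bounded (range (\<lambda>t. F x (c t)))"
      by (rule bounded_subset[OF compact_imp_bounded[OF compact_continuous_image[OF cont_F compact_Icc]]])
        (use c in auto)
    ultimately show ?thesis unfolding P_def by (subst Bcontfun_inverse) (auto simp: bcontfun_def)
  qed
  have contraction: "dist (P x) (P x') \<le> 1 / 2 * dist x x'" for x x'
  proof (rule dist_bound)
    fix t
    define s where "s = c t"
    have s: "0 \<le> s" using c(1)[of t] by (simp add: s_def)
    define D where "D = dist x x'"
    have "((\<lambda>r. L * D * exp (k * r)) has_integral (L * D / k * exp (k * s) - L * D / k * exp (k * 0))) {0..s}"
      by (rule fundamental_theorem_of_calculus[OF s])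
        (use k in \<open>auto intro!: derivative_eq_intros simp flip: has_real_derivative_iff_has_vector_derivative\<close>)
    then have I: "((\<lambda>r. L * D * exp (k * r)) has_integral (L * D / k * (exp (k * s) - 1))) {0..s}"
      by (simp add: algebra_simps)
    have "norm (integral {0..s} (\<lambda>r. g x r - g x' r)) \<le> integral {0..s} (\<lambda>r. L * D * exp (k * r))"
    proof (rule integral_norm_bound_integral)
      show "(\<lambda>r. g x r - g x' r) integrable_on {0..s}" by (intro integrable_diff int_g)
      show "(\<lambda>r. L * D * exp (k * r)) integrable_on {0..s}" using I by blast
      fix r
      have "norm (g x r - g x' r) \<le> L * norm (exp (k * r) *\<^sub>R apply_bcontfun x r - exp (k * r) *\<^sub>R apply_bcontfun x' r)"
        unfolding g_def by (rule L(2))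
      also have "\<dots> = L * (exp (k * r) * dist (apply_bcontfun x r) (apply_bcontfun x' r))"
        by (simp add: dist_norm flip: scaleR_diff_right)
      also have "\<dots> \<le> L * (exp (k * r) * D)"
        unfolding D_def using L by (intro mult_left_mono dist_bounded) auto
      finally show "norm (g x r - g x' r) \<le> L * D * exp (k * r)" by (simp add: mult_ac)
    qed
    also have "\<dots> = L * D / k * (exp (k * s) - 1)" using I by (rule integral_unique)
    also have "\<dots> \<le> L * D / k * exp (k * s)" using L k by (intro mult_left_mono) (auto simp: D_def)
    finally have J: "norm (integral {0..s} (g x) - integral {0..s} (g x')) \<le> L * D / k * exp (k * s)"
      by (simp add: integral_diff[OF int_g int_g])
    have "dist (P x t) (P x' t) = exp (- k * s) * norm (integral {0..s} (g x) - integral {0..s} (g x'))"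
      by (simp add: P F_def s_def[symmetric] dist_norm flip: scaleR_diff_right)
    also have "\<dots> \<le> exp (- k * s) * (L * D / k * exp (k * s))" by (intro mult_left_mono J) simp
    also have "\<dots> = L / k * D" by (simp add: exp_minus field_simps)
    also have "\<dots> \<le> 1 / 2 * D" using k L by (intro mult_right_mono) (auto simp: D_def field_simps)
    finally show "dist (P x t) (P x' t) \<le> 1 / 2 * dist x x'" by (simp add: D_def)
  qed
  have "\<exists>!x. P x = x"
    by (rule banach_fix_type[of "1 / 2"]) (use contraction in auto)
  then obtain x where x: "P x = x" by blast
  define y where "y t = y0 + integral {0..t} (g x)" for t
  show ?thesis
  proof (rule that[of y])
    show "y 0 = y0" by (simp add: y_def)
    fix t assume t: "t \<in> {0..b}"
    have "apply_bcontfun x t = F x t" using P[of x t] x t by (simp add: c_def)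
    then have "exp (k * t) *\<^sub>R apply_bcontfun x t = y t"
      by (simp add: F_def y_def flip: exp_add)
    then have "g x t = f (y t)" by (simp add: g_def)
    then show "(y has_vector_derivative f (y t)) (at t within {0..b})"
      using integral_has_vector_derivative[OF cont_g t, of x]
      unfolding y_def[abs_def] by (auto intro!: derivative_eq_intros)
  qed
qed

text \<open>The force is made globally Lipschitz by projecting the position to \<open>cball 0 K\<close>; under the
  a priori bound the solution never notices.\<close>

lemma smoothed_motion_exists:
  fixes q p :: "'a::euclidean_space"
  assumes sm: "smooth_pos V" and \<epsilon>: "0 < \<epsilon>" and b: "0 \<le> b" and q: "norm q < K"
    and bound: "\<And>c u v. c \<in> {0..b} \<Longrightarrow> central_motion V \<epsilon> {0..c} u v \<Longrightarrow> u 0 = q \<Longrightarrow> v 0 = p \<Longrightarrow> norm (u c) < K"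
  obtains u v where "u 0 = q" "v 0 = p" "central_motion V \<epsilon> {0..b} u v"
proof -
  have K: "0 < K" using q by (smt (verit) norm_ge_zero)
  \<comment> \<open>The projection is 1-Lipschitz and its values keep \<sigma> in
    [\<epsilon>^2, K^2 + \<epsilon>^2], so the Lipschitz bound on that range becomes global.\<close>
  define P where "P = closest_point (cball (0::'a) K)"
  have P_in: "norm (P x) \<le> K" for x
    using closest_point_in_set[of "cball (0::'a) K" x] K by (simp add: P_def)
  have P_self: "P x = x" if "norm x \<le> K" for x
    unfolding P_def using that by (intro closest_point_self) simp
  have P_lip: "norm (P x - P y) \<le> norm (x - y)" for x y
    using closest_point_lipschitz[of "cball (0::'a) K" x y] K by (simp add: P_def dist_norm)
  define G where "G x = force_coeff V (P x \<bullet> P x + \<epsilon>\<^sup>2) *\<^sub>R P x" for x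
  have "0 < \<epsilon>\<^sup>2" using \<epsilon> by simp
  obtain L where L: "0 \<le> L"
    "\<And>\<epsilon>' \<epsilon>'' (x::'a) y. x \<bullet> x + \<epsilon>'\<^sup>2 \<in> {\<epsilon>\<^sup>2..K\<^sup>2 + \<epsilon>\<^sup>2} \<Longrightarrow> y \<bullet> y + \<epsilon>''\<^sup>2 \<in> {\<epsilon>\<^sup>2..K\<^sup>2 + \<epsilon>\<^sup>2} \<Longrightarrow>
      norm (force_coeff V (x \<bullet> x + \<epsilon>'\<^sup>2) *\<^sub>R x - force_coeff V (y \<bullet> y + \<epsilon>''\<^sup>2) *\<^sub>R y)
        \<le> L * (norm (x - y) + \<bar>\<epsilon>'\<^sup>2 - \<epsilon>''\<^sup>2\<bar>)"
    by (rule force_lipschitz[OF sm \<open>0 < \<epsilon>\<^sup>2\<close>]) (rule that; assumption)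
  have PK: "P x \<bullet> P x + \<epsilon>\<^sup>2 \<in> {\<epsilon>\<^sup>2..K\<^sup>2 + \<epsilon>\<^sup>2}" for x
    using power_mono[OF P_in[of x] norm_ge_zero, of 2] by (simp add: power2_norm_eq_inner)
  have G_lip: "norm (G x - G y) \<le> L * norm (x - y)" for x y
  proof -
    have "norm (G x - G y) \<le> L * norm (P x - P y)"
      unfolding G_def using L(2)[OF PK PK, of x y] by simp
    also have "\<dots> \<le> L * norm (x - y)" using L(1) P_lip by (intro mult_left_mono)
    finally show ?thesis .
  qed
  define f where "f s = (snd s, G (fst s))" for s :: "'a \<times> 'a"
  have f_lip: "norm (f s - f s') \<le> (1 + L) * norm (s - s')" for s s'
  proof -
    have "norm (f s - f s') \<le> norm (snd s - snd s') + norm (G (fst s) - G (fst s'))"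
      unfolding f_def by (simp add: norm_Pair_le)
    also have "\<dots> \<le> norm (s - s') + L * norm (s - s')"
    proof (intro add_mono)
      have eq: "s - s' = (fst s - fst s', snd s - snd s')" by (simp add: prod_eq_iff)
      show "norm (snd s - snd s') \<le> norm (s - s')" unfolding eq by (rule norm_snd_le)
      have "norm (fst s - fst s') \<le> norm (s - s')" unfolding eq by (rule norm_fst_le)
      then show "norm (G (fst s) - G (fst s')) \<le> L * norm (s - s')"
        using G_lip[of "fst s" "fst s'"] L(1) by (meson mult_left_mono order_trans)
    qed
    finally show ?thesis by (simp add: algebra_simps)
  qed
  have L1: "0 \<le> 1 + L" using L(1) by simp
  obtain y where y: "y 0 = (q, p)" "\<And>t. t \<in> {0..b} \<Longrightarrow> (y has_vector_derivative f (y t)) (at t within {0..b})"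
    by (rule lipschitz_ode_exists[OF L1 f_lip b, of "(q, p)"]) (rule that; assumption)
  define u v where "u t = fst (y t)" and "v t = snd (y t)" for t
  have du: "(u has_vector_derivative v t) (at t within {0..b})"
    and dv: "(v has_vector_derivative G (u t)) (at t within {0..b})" if t: "t \<in> {0..b}" for t
    using bounded_linear.has_vector_derivative[OF bounded_linear_fst y(2)[OF t]]
      bounded_linear.has_vector_derivative[OF bounded_linear_snd y(2)[OF t]]
    by (simp_all add: u_def[abs_def] v_def[abs_def] f_def)
  have motion: "central_motion V \<epsilon> {0..c} u v" if c: "c \<le> b" and le: "\<And>t. t \<in> {0..c} \<Longrightarrow> norm (u t) \<le> K" for c
    unfolding central_motion_def
  proof (intro ballI conjI)
    fix t assume t: "t \<in> {0..c}"
    have sub: "{0..c} \<subseteq> {0..b}" using c by auto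
    show "0 < u t \<bullet> u t + \<epsilon>\<^sup>2" using \<epsilon> by (simp add: add_nonneg_pos)
    show "(u has_vector_derivative v t) (at t within {0..c})"
      using has_vector_derivative_within_subset[OF du sub] t sub by blast
    have "G (u t) = force_coeff V (u t \<bullet> u t + \<epsilon>\<^sup>2) *\<^sub>R u t"
      by (simp add: G_def P_self[OF le[OF t]])
    then show "(v has_vector_derivative force_coeff V (u t \<bullet> u t + \<epsilon>\<^sup>2) *\<^sub>R u t) (at t within {0..c})"
      using has_vector_derivative_within_subset[OF dv sub, of t] t sub by auto
  qed
  have init: "u 0 = q" "v 0 = p" using y(1) by (auto simp: u_def v_def)
  have "norm (u t) < K" if t: "t \<in> {0..b}" for t
  proof (rule ccontr)
    assume "\<not> norm (u t) < K"
    then have tK: "K \<le> norm (u t)" by simp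
    have cont: "continuous_on {0..b} (\<lambda>t. norm (u t))"
      using du by (intro continuous_on_norm) (meson continuous_on_eq_continuous_within has_vector_derivative_continuous)
    have "norm (u 0) \<le> K" using init q by simp
    \<comment> \<open>Up to the first time at which |u| reaches K the projection acts as the
      identity, so this is a genuine motion and the a priori bound applies at
      \<open>c\<close>.\<close>
    from cont this t tK obtain c where c: "c \<in> {0..t}" "norm (u c) = K" "\<And>s. s \<in> {0..c} \<Longrightarrow> norm (u s) \<le> K"
      by (rule first_hitting_time) (rule that; assumption)
    have "norm (u c) < K"
      by (rule bound[OF _ motion[OF _ c(3)] init]) (use c t in auto)
    then show False using c(2) by simp
  qed
  then have "central_motion V \<epsilon> {0..b} u v" by (intro motion) (auto intro: less_imp_le)
  then show ?thesis using that init by blast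
qed

section \<open>Regularization\<close>

lemma smoothing_norm: "smoothing V \<epsilon> (norm x) = V (sqrt (x \<bullet> x + \<epsilon>\<^sup>2))"
  by (simp add: smoothing_def power2_norm_eq_inner)

text \<open>The gradient is unique, hence an equivalence: it eliminates the existentially quantified
  acceleration in \<open>newton_solution\<close>.\<close>

lemma smoothing_gradient:
  fixes x :: "'a::real_inner"
  assumes "smooth_pos V" "0 < x \<bullet> x + \<epsilon>\<^sup>2"
  shows "GDERIV (\<lambda>x. smoothing V \<epsilon> (norm x)) x :> a \<longleftrightarrow> a = force_coeff V (x \<bullet> x + \<epsilon>\<^sup>2) *\<^sub>R x"
proof -
  let ?b = "force_coeff V (x \<bullet> x + \<epsilon>\<^sup>2) *\<^sub>R x"
  have "((\<lambda>x. x \<bullet> x + \<epsilon>\<^sup>2) has_derivative (\<lambda>h. 2 * (x \<bullet> h))) (at x)"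
    by (auto intro!: derivative_eq_intros simp: inner_commute)
  from DERIV_compose_FDERIV[OF potential_sqrt_derivative[OF assms] this]
  have b: "((\<lambda>x. smoothing V \<epsilon> (norm x)) has_derivative (\<lambda>h. h \<bullet> ?b)) (at x)"
    unfolding smoothing_norm by (rule has_derivative_eq_rhs) (auto simp: inner_commute)
  show ?thesis
  proof
    assume "GDERIV (\<lambda>x. smoothing V \<epsilon> (norm x)) x :> a"
    from has_derivative_unique[OF this[unfolded gderiv_def] b] have "\<forall>h. h \<bullet> a = h \<bullet> ?b" by meson
    then show "a = ?b" by (simp only: vector_eq_ldot)
  qed (use b in \<open>simp add: gderiv_def\<close>)
qed

text \<open>The set where \<sigma> > 0 is the complement of the centre for \<epsilon> = 0 and the
  whole space for \<epsilon> > 0, so one statement serves both kinds of solution.\<close>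

lemma newton_solution_central_motion:
  assumes sm: "smooth_pos V" and D: "D = {x. 0 < x \<bullet> x + \<epsilon>\<^sup>2}"
  shows "newton_solution (\<lambda>x. smoothing V \<epsilon> (norm x)) D I \<nu> u \<longleftrightarrow>
     (\<exists>v. u 0 = fst \<nu> \<and> v 0 = snd \<nu> \<and> central_motion V \<epsilon> I u v)"
  unfolding newton_solution_def central_motion_def D
  by (intro ex_cong1 conj_cong refl ball_cong) (auto simp: smoothing_gradient[OF sm])

lemma newton_flow_central_motion:
  assumes sm: "smooth_pos V" and D: "D = {x. 0 < x \<bullet> x + \<epsilon>\<^sup>2}" and t: "0 \<le> t"
    and uv: "central_motion V \<epsilon> {0..t} u v" "u 0 = fst \<nu>" "v 0 = snd \<nu>"
  shows "newton_flow (\<lambda>x. smoothing V \<epsilon> (norm x)) D \<nu> t = u t"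
  unfolding newton_flow_def newton_solution_central_motion[OF sm D]
proof (rule the_equality)
  show "\<exists>w. (\<exists>v. w 0 = fst \<nu> \<and> v 0 = snd \<nu> \<and> central_motion V \<epsilon> {0..t} w v) \<and> w t = u t"
    using uv by blast
  fix x assume "\<exists>w. (\<exists>v. w 0 = fst \<nu> \<and> v 0 = snd \<nu> \<and> central_motion V \<epsilon> {0..t} w v) \<and> w t = x"
  then show "x = u t"
    using central_motion_unique(1)[OF sm uv(1)] uv(2,3) t by (metis atLeastAtMost_iff order_refl)
qed

lemma classical_domain: "- {0} = {x::'a::real_inner. 0 < x \<bullet> x + 0\<^sup>2}"
  by auto

lemma smoothed_domain: "0 < \<epsilon> \<Longrightarrow> UNIV = {x::'a::real_inner. 0 < x \<bullet> x + \<epsilon>\<^sup>2}"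
  by (auto simp: add_nonneg_pos)

lemma classical_potential: "(\<lambda>x. V (norm x)) = (\<lambda>x. smoothing V 0 (norm x))"
  by (simp add: smoothing_def)

lemmas classical_solution_iff =
  newton_solution_central_motion[OF _ classical_domain, folded classical_potential]
lemmas classical_flow_eq =
  newton_flow_central_motion[OF _ classical_domain, folded classical_potential]
lemmas smoothed_solution_iff = newton_solution_central_motion[OF _ smoothed_domain]
lemmas smoothed_flow_eq = newton_flow_central_motion[OF _ smoothed_domain]

text \<open>The value \<open>\<epsilon> = 0\<close> is allowed, so that classical and smoothed motions are controlled at
  once.\<close>

definition stable_at :: "(real \<Rightarrow> real) \<Rightarrow> state \<Rightarrow> real \<Rightarrow> real^2 \<Rightarrow> bool" where
  "stable_at V \<nu> t y \<longleftrightarrow>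
     (\<forall>e>0. \<exists>d>0. \<forall>\<epsilon> \<mu> u v. 0 \<le> \<epsilon> \<longrightarrow> \<epsilon> < d \<longrightarrow> dist \<mu> \<nu> < d \<longrightarrow> u 0 = fst \<mu> \<longrightarrow> v 0 = snd \<mu> \<longrightarrow>
        central_motion V \<epsilon> {0..t} u v \<longrightarrow> dist (u t) y < e)"

lemma classical_motion_stable:
  assumes sm: "smooth_pos V" and t: "0 \<le> t"
    and uv: "central_motion V 0 {0..t} u v" "u 0 = fst \<nu>" "v 0 = snd \<nu>"
  shows "stable_at V \<nu> t (u t)"
  unfolding stable_at_def
proof (intro allI impI)
  fix e :: real assume "0 < e"
  obtain d where d: "0 < d" and "d \<le> 1" and d': "\<And>\<epsilon> u' v' c s. 0 \<le> \<epsilon> \<Longrightarrow> \<epsilon> < d \<Longrightarrow> c \<le> t \<Longrightarrow>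
       central_motion V \<epsilon> {0..c} u' v' \<Longrightarrow>
       dist (u' 0) (u 0) < d \<Longrightarrow> dist (v' 0) (v 0) < d \<Longrightarrow> s \<in> {0..c} \<Longrightarrow>
       dist (u' s) (u s) < e \<and> dist (v' s) (v s) < e"
    by (rule central_motion_continuous_dependence[OF sm uv(1) \<open>0 < e\<close>]) (rule that; assumption)
  have "dist (u' t) (u t) < e" if "0 \<le> \<epsilon>" "\<epsilon> < d" "dist \<mu> \<nu> < d" "u' 0 = fst \<mu>" "v' 0 = snd \<mu>"
      "central_motion V \<epsilon> {0..t} u' v'" for \<epsilon> \<mu> u' v'
    using d'[OF that(1,2) order_refl that(6), of t] that(3-5) t uv(2,3)
      dist_fst_le[of \<mu> \<nu>] dist_snd_le[of \<mu> \<nu>] by auto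
  then show "\<exists>d>0. \<forall>\<epsilon> \<mu> u' v'. 0 \<le> \<epsilon> \<longrightarrow> \<epsilon> < d \<longrightarrow> dist \<mu> \<nu> < d \<longrightarrow> u' 0 = fst \<mu> \<longrightarrow> v' 0 = snd \<mu> \<longrightarrow>
        central_motion V \<epsilon> {0..t} u' v' \<longrightarrow> dist (u' t) (u t) < e"
    using d by blast
qed

text \<open>The limit is the transmission path. Its estimate holds for motions on every [0, c] with
  c \<le> t and serves twice: at c = t it is stability, and for all c it is the a priori bound that
  makes the smoothed motions last until t.\<close>

lemma collision_stable:
  assumes V: "V \<in> class_V_star" and S: "admissible_bound V S"
    and coll: "collides_at V R \<nu> T" and t: "0 \<le> t" "t \<le> 2 * T"
  obtains y where "stable_at V \<nu> t y"
    "\<exists>d>0. \<forall>\<epsilon> \<mu>. 0 < \<epsilon> \<longrightarrow> \<epsilon> < d \<longrightarrow> dist \<mu> \<nu> < d \<longrightarrow>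
       (\<exists>u v. u 0 = fst \<mu> \<and> v 0 = snd \<mu> \<and> central_motion V \<epsilon> {0..t} u v)"
proof -
  have sm: "smooth_pos V" using V by (auto simp: class_V_star_def class_V_def)
  obtain w z where T: "0 < T" and wz: "central_motion V 0 {0..<T} w z" "w 0 = fst \<nu>" "z 0 = snd \<nu>"
    and lim: "(w \<longlongrightarrow> 0) (at_left T)"
    using coll unfolding collides_at_def classical_solution_iff[OF sm] by blast
  let ?W = "transmission_path T w"
  have key: "\<exists>d>0. \<forall>\<epsilon> \<mu> u v c. 0 \<le> \<epsilon> \<longrightarrow> \<epsilon> < d \<longrightarrow> dist \<mu> \<nu> < d \<longrightarrow> u 0 = fst \<mu> \<longrightarrow> v 0 = snd \<mu> \<longrightarrow>
      0 \<le> c \<longrightarrow> c \<le> t \<longrightarrow> central_motion V \<epsilon> {0..c} u v \<longrightarrow> dist (u c) (?W c) < e" if e: "0 < e" for e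
  proof -
    obtain d where d: "0 < d" and d':
      "\<And>\<epsilon> u v c t. 0 \<le> \<epsilon> \<Longrightarrow> \<epsilon> < d \<Longrightarrow> c \<le> 2 * T \<Longrightarrow> central_motion V \<epsilon> {0..c} u v \<Longrightarrow>
       dist (u 0) (w 0) < d \<Longrightarrow> dist (v 0) (z 0) < d \<Longrightarrow> t \<in> {0..c} \<Longrightarrow> dist (u t) (?W t) < e"
      by (rule collision_transmission[OF V S wz(1) T lim e]) (rule that; assumption)
    have "dist (u c) (?W c) < e" if "0 \<le> \<epsilon>" "\<epsilon> < d" "dist \<mu> \<nu> < d" "u 0 = fst \<mu>" "v 0 = snd \<mu>"
      "0 \<le> c" "c \<le> t" "central_motion V \<epsilon> {0..c} u v" for \<epsilon> \<mu> u v c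
      using d'[OF that(1,2) _ that(8), of c] that(3-7) t wz(2,3)
        dist_fst_le[of \<mu> \<nu>] dist_snd_le[of \<mu> \<nu>] by auto
    then show ?thesis using d by blast
  qed
  show ?thesis
  proof (rule that[of "?W t"])
    show "stable_at V \<nu> t (?W t)"
      unfolding stable_at_def using key t(1) by (meson order_refl)
    \<comment> \<open>Near T the path is bounded by 1 because w tends to 0; the earlier part is
      compact.\<close>
    obtain B where B: "\<And>s. s \<in> {0..2 * T} \<Longrightarrow> norm (?W s) \<le> B"
    proof -
      have "\<forall>\<^sub>F s in at_left T. norm (w s) < 1"
        using order_tendstoD(2)[OF tendsto_norm[OF lim], of 1] by simp
      then obtain b where b: "b < T" "\<And>s. b < s \<Longrightarrow> s < T \<Longrightarrow> norm (w s) < 1"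
        by (auto simp: eventually_at_left_field)
      have "continuous_on {0..b} w" 
        using b by (intro central_motion_continuous[OF central_motion_subset[OF wz(1)]]) auto
      from compact_imp_bounded[OF compact_continuous_image[OF this compact_Icc]]
      obtain C where C: "\<forall>s\<in>{0..b}. norm (w s) \<le> C" by (auto simp: bounded_iff)
      have "norm (w s) \<le> max C 1" if "0 \<le> s" "s < T" for s
        using C b(2)[of s] that by (cases "s \<le> b") (auto simp: le_max_iff_disj)
      then have "norm (?W s) \<le> max C 1" if "s \<in> {0..2 * T}" for s
        using that by (auto simp: transmission_path_def)
      then show ?thesis using that by blast
    qed
    obtain d where d: "0 < d" and d': "\<And>\<epsilon> \<mu> u v c. 0 \<le> \<epsilon> \<Longrightarrow> \<epsilon> < d \<Longrightarrow> dist \<mu> \<nu> < d \<Longrightarrow> u 0 = fst \<mu> \<Longrightarrow>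
      v 0 = snd \<mu> \<Longrightarrow> 0 \<le> c \<Longrightarrow> c \<le> t \<Longrightarrow> central_motion V \<epsilon> {0..c} u v \<Longrightarrow> dist (u c) (?W c) < 1"
      using key[of 1] by auto
    have "\<exists>u v. u 0 = fst \<mu> \<and> v 0 = snd \<mu> \<and> central_motion V \<epsilon> {0..t} u v"
      if \<epsilon>: "0 < \<epsilon>" "\<epsilon> < d" and \<mu>: "dist \<mu> \<nu> < min d 1" for \<epsilon> \<mu>
    proof -
      have near: "norm x < B + 1" if "dist x (?W c) < 1" "0 \<le> c" "c \<le> t" for x c
        using B[of c] that t norm_triangle_sub[of x "?W c"] by (simp add: dist_norm)
      have "norm (fst \<mu>) < B + 1"
        using near[of "fst \<mu>" 0] dist_fst_le[of \<mu> \<nu>] \<mu> t T wz(2) by (simp add: transmission_path_def)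
      moreover have "norm (u c) < B + 1"
        if "c \<in> {0..t}" "central_motion V \<epsilon> {0..c} u v" "u 0 = fst \<mu>" "v 0 = snd \<mu>" for c u v
        using d'[OF _ \<epsilon>(2) _ that(3,4) _ _ that(2)] \<epsilon>(1) \<mu> that(1) by (intro near) auto
      ultimately obtain u v where "u 0 = fst \<mu>" "v 0 = snd \<mu>" "central_motion V \<epsilon> {0..t} u v"
        using smoothed_motion_exists[OF sm \<epsilon>(1) t(1), of "fst \<mu>" "B + 1" "snd \<mu>"] by metis
      then show ?thesis by blast
    qed
    then show "\<exists>d>0. \<forall>\<epsilon> \<mu>. 0 < \<epsilon> \<longrightarrow> \<epsilon> < d \<longrightarrow> dist \<mu> \<nu> < d \<longrightarrow>
       (\<exists>u v. u 0 = fst \<mu> \<and> v 0 = snd \<mu> \<and> central_motion V \<epsilon> {0..t} u v)"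
      using d by (intro exI[of _ "min d 1"]) auto
  qed
qed

section \<open>From stability to the smoothing limit and to continuity\<close>

lemma eventually_smoothing_filter:
  fixes \<nu> :: state
  assumes "0 < d" "\<And>\<epsilon> \<mu>. 0 < \<epsilon> \<Longrightarrow> \<epsilon> < d \<Longrightarrow> dist \<mu> \<nu> < d \<Longrightarrow> P (\<epsilon>, \<mu>)"
  shows "\<forall>\<^sub>F x in at_right (0::real) \<times>\<^sub>F nhds \<nu>. P x"
proof -
  have "\<forall>\<^sub>F \<epsilon> in at_right (0::real). 0 < \<epsilon> \<and> \<epsilon> < d"
    using assms(1) by (auto simp: eventually_at_right_field)
  moreover have "\<forall>\<^sub>F \<mu> in nhds \<nu>. dist \<mu> \<nu> < d"
    using assms(1) by (auto simp: eventually_nhds_metric)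
  ultimately have "\<forall>\<^sub>F x in at_right (0::real) \<times>\<^sub>F nhds \<nu>. (0 < fst x \<and> fst x < d) \<and> dist (snd x) \<nu> < d"
    by (rule eventually_prodI)
  then show ?thesis
    by eventually_elim (use assms(2) in \<open>metis prod.collapse\<close>)
qed

lemma smoothing_filter_nontrivial: "at_right (0::real) \<times>\<^sub>F nhds (\<nu>::state) \<noteq> bot"
  by (simp add: prod_filter_eq_bot)

text \<open>Stability alone is vacuous where no motion exists; existence for small \<epsilon> turns
  it into a limit of flows.\<close>

lemma stable_smoothing_limit:
  assumes sm: "smooth_pos V" and t: "0 \<le> t" and st: "stable_at V \<nu> t y"
    and ex: "\<exists>d>0. \<forall>\<epsilon> \<mu>. 0 < \<epsilon> \<longrightarrow> \<epsilon> < d \<longrightarrow> dist \<mu> \<nu> < d \<longrightarrow>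
       (\<exists>u v. u 0 = fst \<mu> \<and> v 0 = snd \<mu> \<and> central_motion V \<epsilon> {0..t} u v)"
  shows "smoothing_limit V \<nu> t y"
proof -
  obtain d0 where d0: "0 < d0" "\<And>\<epsilon> \<mu>. 0 < \<epsilon> \<Longrightarrow> \<epsilon> < d0 \<Longrightarrow> dist \<mu> \<nu> < d0 \<Longrightarrow>
       \<exists>u v. u 0 = fst \<mu> \<and> v 0 = snd \<mu> \<and> central_motion V \<epsilon> {0..t} u v" using ex by blast
  show ?thesis
    unfolding smoothing_limit_def
  proof
    show "\<forall>\<^sub>F (\<epsilon>, \<mu>) in at_right 0 \<times>\<^sub>F nhds \<nu>. \<exists>u. smoothed_solution V \<epsilon> {0..t} \<mu> u"
    proof (rule eventually_smoothing_filter[OF d0(1)])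
      fix \<epsilon> \<mu> assume "0 < \<epsilon>" "\<epsilon> < d0" "dist \<mu> \<nu> < d0"
      then obtain u where "smoothed_solution V \<epsilon> {0..t} \<mu> u"
        using d0(2)[of \<epsilon> \<mu>] smoothed_solution_iff[OF sm, of \<epsilon>] by blast
      then show "case (\<epsilon>, \<mu>) of (\<epsilon>, \<mu>) \<Rightarrow> \<exists>u. smoothed_solution V \<epsilon> {0..t} \<mu> u" by auto
    qed
    show "((\<lambda>(\<epsilon>, \<mu>). smoothed_flow V \<epsilon> \<mu> t) \<longlongrightarrow> y) (at_right 0 \<times>\<^sub>F nhds \<nu>)"
    proof (rule tendstoI)
      fix e :: real assume "0 < e"
      then obtain d where d: "0 < d" "\<And>\<epsilon> \<mu> u v. 0 \<le> \<epsilon> \<Longrightarrow> \<epsilon> < d \<Longrightarrow> dist \<mu> \<nu> < d \<Longrightarrow> u 0 = fst \<mu> \<Longrightarrow> v 0 = snd \<mu> \<Longrightarrow>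
        central_motion V \<epsilon> {0..t} u v \<Longrightarrow> dist (u t) y < e"
        using st unfolding stable_at_def by metis
      show "\<forall>\<^sub>F x in at_right 0 \<times>\<^sub>F nhds \<nu>. dist (case x of (\<epsilon>, \<mu>) \<Rightarrow> smoothed_flow V \<epsilon> \<mu> t) y < e"
      proof (rule eventually_smoothing_filter[of "min d d0"])
        show "0 < min d d0" using d d0 by simp
        fix \<epsilon> \<mu> assume *: "0 < \<epsilon>" "\<epsilon> < min d d0" "dist \<mu> \<nu> < min d d0"
        then obtain u v where uv: "u 0 = fst \<mu>" "v 0 = snd \<mu>" "central_motion V \<epsilon> {0..t} u v"
          using d0(2)[of \<epsilon> \<mu>] by auto
        then show "dist (case (\<epsilon>, \<mu>) of (\<epsilon>, \<mu>) \<Rightarrow> smoothed_flow V \<epsilon> \<mu> t) y < e"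
          using smoothed_flow_eq[OF sm *(1) t uv(3,1,2)] d(2)[of \<epsilon> \<mu> u v] * by simp
      qed
    qed
  qed
qed

text \<open>Stability at \<nu> controls the smoothed motions from all data near \<mu> once \<mu> is
  close to \<nu>. Letting \<epsilon> tend to 0 bounds the limit attached to \<mu>, without following
  how the collision time depends on the datum.\<close>

lemma stable_smoothing_limit_near:
  assumes sm: "smooth_pos V" and t: "0 \<le> t" and st: "stable_at V \<nu> t y" and e: "0 < e"
  obtains d where "0 < d" "\<And>\<mu> y'. dist \<mu> \<nu> < d \<Longrightarrow> smoothing_limit V \<mu> t y' \<Longrightarrow> dist y' y \<le> e"
proof -
  obtain d where d: "0 < d" "\<And>\<epsilon> \<mu> u v. 0 \<le> \<epsilon> \<Longrightarrow> \<epsilon> < d \<Longrightarrow> dist \<mu> \<nu> < d \<Longrightarrow> u 0 = fst \<mu> \<Longrightarrow> v 0 = snd \<mu> \<Longrightarrow>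
        central_motion V \<epsilon> {0..t} u v \<Longrightarrow> dist (u t) y < e"
    using st e unfolding stable_at_def by metis
  show ?thesis
  proof (rule that[OF d(1)])
    fix \<mu> y' assume \<mu>: "dist \<mu> \<nu> < d" and lim: "smoothing_limit V \<mu> t y'"
    have "\<forall>\<^sub>F x in at_right (0::real) \<times>\<^sub>F nhds \<mu>. 0 < fst x \<and> fst x < d \<and> dist (snd x) \<nu> < d"
    proof (rule eventually_smoothing_filter[of "d - dist \<mu> \<nu>"])
      fix \<epsilon> \<mu>' assume "0 < \<epsilon>" "\<epsilon> < d - dist \<mu> \<nu>" "dist \<mu>' \<mu> < d - dist \<mu> \<nu>"
      then show "0 < fst (\<epsilon>, \<mu>') \<and> fst (\<epsilon>, \<mu>') < d \<and> dist (snd (\<epsilon>, \<mu>')) \<nu> < d"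
        using dist_triangle[of \<mu>' \<nu> \<mu>] zero_le_dist[of \<mu> \<nu>] by (auto simp del: zero_le_dist)
    qed (use \<mu> in simp)
    moreover have "\<forall>\<^sub>F (\<epsilon>, \<mu>) in at_right 0 \<times>\<^sub>F nhds \<mu>. \<exists>u. smoothed_solution V \<epsilon> {0..t} \<mu> u"
      using lim by (auto simp: smoothing_limit_def)
    ultimately have "\<forall>\<^sub>F x in at_right 0 \<times>\<^sub>F nhds \<mu>. dist (case x of (\<epsilon>, \<mu>) \<Rightarrow> smoothed_flow V \<epsilon> \<mu> t) y \<le> e"
    proof eventually_elim
      case (elim x)
      obtain \<epsilon> \<mu>' where x: "x = (\<epsilon>, \<mu>')" by (cases x)
      have \<epsilon>: "0 < \<epsilon>" "\<epsilon> < d" "dist \<mu>' \<nu> < d" using elim x by auto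
      obtain u v where uv: "u 0 = fst \<mu>'" "v 0 = snd \<mu>'" "central_motion V \<epsilon> {0..t} u v"
        using elim(2) smoothed_solution_iff[OF sm \<epsilon>(1)] unfolding x by blast
      show ?case
        using smoothed_flow_eq[OF sm \<epsilon>(1) t uv(3,1,2)] d(2)[of \<epsilon> \<mu>' u v] uv \<epsilon> by (simp add: x)
    qed
    moreover have l: "((\<lambda>(\<epsilon>, \<mu>). smoothed_flow V \<epsilon> \<mu> t) \<longlongrightarrow> y') (at_right 0 \<times>\<^sub>F nhds \<mu>)"
      using lim by (simp add: smoothing_limit_def)
    ultimately show "dist y' y \<le> e"
      using tendsto_upperbound[OF tendsto_dist[OF l tendsto_const] _ smoothing_filter_nontrivial] by blast
  qed
qed

text \<open>Stability at \<nu> concerns all motions starting close to \<nu>, classical or smoothed.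
  A neighbouring value of the regularized flow is the endpoint of a classical motion or a limit of
  smoothed ones, so it is controlled in both cases.\<close>

theorem theorem1:
  fixes V :: "real \<Rightarrow> real" and S T :: ereal
  assumes "V \<in> class_V_star"
    and "admissible_bound V S"
    and "T_star_bound V T"
  shows "strongly_regularizable V (min T S)"
proof -
  let ?R = "min T S"
  have sm: "smooth_pos V" using assms(1) by (auto simp: class_V_star_def class_V_def)
  \<comment> \<open>Chosen for all \<nu> and t; for collision data uniqueness of limits identifies
    it with the stable value.\<close>
  define w where "w \<nu> t = (SOME y. smoothing_limit V \<nu> t y)" for \<nu> t
  have coll: "stable_at V \<nu> t (w \<nu> t) \<and> smoothing_limit V \<nu> t (w \<nu> t)"
    if c: "collides_at V ?R \<nu> T0" and t: "0 \<le> t" "t \<le> 2 * T0" for \<nu> T0 t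
  proof -
    obtain y where y: "stable_at V \<nu> t y"
      and ex: "\<exists>d>0. \<forall>\<epsilon> \<mu>. 0 < \<epsilon> \<longrightarrow> \<epsilon> < d \<longrightarrow> dist \<mu> \<nu> < d \<longrightarrow>
       (\<exists>u v. u 0 = fst \<mu> \<and> v 0 = snd \<mu> \<and> central_motion V \<epsilon> {0..t} u v)"
      by (rule collision_stable[OF assms(1,2) c t])
    have lim: "smoothing_limit V \<nu> t y" by (rule stable_smoothing_limit[OF sm t(1) y ex])
    have w: "smoothing_limit V \<nu> t (w \<nu> t)" unfolding w_def using lim by (rule someI)
    have "w \<nu> t = y"
      using tendsto_unique[OF smoothing_filter_nontrivial] w lim unfolding smoothing_limit_def by blast
    then show ?thesis using y lim by simp
  qed
  have dom: "stable_at V \<nu> t (regularized_flow V ?R w \<nu> t) \<and>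
      (smoothing_limit V \<nu> t (regularized_flow V ?R w \<nu> t) \<or>
       (\<exists>u v. u 0 = fst \<nu> \<and> v 0 = snd \<nu> \<and> central_motion V 0 {0..t} u v \<and> u t = regularized_flow V ?R w \<nu> t))"
    if t: "0 \<le> t" and \<nu>: "\<nu> \<in> regularized_domain V ?R t" for \<nu> t
  proof (cases "\<nu> \<in> collision_set V ?R")
    case True
    then obtain T0 where "collides_at V ?R \<nu> T0" "t \<le> 2 * T0"
      using \<nu> True by (auto simp: regularized_domain_def)
    then show ?thesis using coll[of \<nu> T0 t] t True by (simp add: regularized_flow_def)
  next
    case False
    then obtain u v where uv: "u 0 = fst \<nu>" "v 0 = snd \<nu>" "central_motion V 0 {0..t} u v"
      using \<nu> False by (auto simp: regularized_domain_def classical_solution_iff[OF sm])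
    have "regularized_flow V ?R w \<nu> t = u t"
      using False classical_flow_eq[OF sm t uv(3,1,2)] by (simp add: regularized_flow_def)
    then show ?thesis using classical_motion_stable[OF sm t uv(3,1,2)] uv by auto
  qed
  show ?thesis
    unfolding strongly_regularizable_def
  proof (intro exI[of _ w] conjI ballI allI impI)
    fix \<nu> T0 t assume "collides_at V ?R \<nu> T0" "t \<in> {0..2 * T0}"
    then show "smoothing_limit V \<nu> t (w \<nu> t)" using coll by auto
  next
    fix t :: real assume t: "0 \<le> t"
    let ?f = "\<lambda>\<nu>. regularized_flow V ?R w \<nu> t"
    show "continuous_on (regularized_domain V ?R t) ?f"
      unfolding continuous_on_iff
    proof (intro ballI allI impI)
      fix \<nu> and e :: real assume \<nu>: "\<nu> \<in> regularized_domain V ?R t" and e: "0 < e"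
      have st: "stable_at V \<nu> t (?f \<nu>)" using dom[OF t \<nu>] by blast
      obtain d1 where d1: "0 < d1" "\<And>\<epsilon> \<mu> u v. 0 \<le> \<epsilon> \<Longrightarrow> \<epsilon> < d1 \<Longrightarrow> dist \<mu> \<nu> < d1 \<Longrightarrow> u 0 = fst \<mu> \<Longrightarrow> v 0 = snd \<mu> \<Longrightarrow>
          central_motion V \<epsilon> {0..t} u v \<Longrightarrow> dist (u t) (?f \<nu>) < e"
        using st e unfolding stable_at_def by metis
      \<comment> \<open>\<open>e / 2\<close>, because passing to the limit yields only a weak
        inequality.\<close>
      obtain d2 where d2: "0 < d2" "\<And>\<mu> y'. dist \<mu> \<nu> < d2 \<Longrightarrow> smoothing_limit V \<mu> t y' \<Longrightarrow> dist y' (?f \<nu>) \<le> e / 2"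
        using stable_smoothing_limit_near[OF sm t st, of "e / 2"] e by auto
      have "dist (?f \<mu>) (?f \<nu>) < e" if "\<mu> \<in> regularized_domain V ?R t" "dist \<mu> \<nu> < min d1 d2" for \<mu>
        using dom[OF t that(1)]
      proof (elim conjE disjE exE)
        assume "smoothing_limit V \<mu> t (?f \<mu>)"
        then show ?thesis using d2(2)[of \<mu> "?f \<mu>"] that e by simp
      next
        fix u v assume "u 0 = fst \<mu>" "v 0 = snd \<mu>" "central_motion V 0 {0..t} u v" "u t = ?f \<mu>"
        then show ?thesis using d1(2)[of 0 \<mu> u v] that d1(1) by simp
      qed
      then show "\<exists>d>0. \<forall>\<mu>\<in>regularized_domain V ?R t. dist \<mu> \<nu> < d \<longrightarrow> dist (?f \<mu>) (?f \<nu>) < e"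
        using d1(1) d2(1) by (intro exI[of _ "min d1 d2"]) auto
    qed
  qed
qed

end
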